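(* Let $D$ be a trigonometric $\Lambda^+$-valued divisor satisfying the integrality assumption, and $T_D(z)$ its trigonometric Lax matrix. Then $\mathsf T_D(z):=z^{\epsilon^\vee_1(\lambda+\mu^-)}\mathsf Z_0(z)^{-1}T_D(z)$ has all entries in $\widetilde{\mathcal A}^v[z]$, i.e. $\mathsf T_D(z)\in\widetilde{\mathcal A}^v[z]\otimes_{\mathbb{C}}\mathrm{End}\,\mathbb{C}^n$.
   Context: Let $n\ge2$, $\Lambda=\bigoplus_{j=1}^n\mathbb{Z}\epsilon_j$, $\epsilon^\vee_j$ dual basis, $\alpha^\vee_i=\epsilon^\vee_i-\epsilon^\vee_{i+1}$, $\alpha_i=\epsilon_i-\epsilon_{i+1}$, $\varpi_i=-\sum_{j>i}\epsilon_j$ ($0\le i\le n-1$), $\Lambda^+=\{\nu:\alpha^\vee_i(\nu)\ge0\ \forall i\}$. A trigonometric $\Lambda^+$-valued divisor: $D=\sum_{s=1}^N\gamma_s\varpi_{i_s}[\mathsf x_s]+\mu^+[\infty]+\mu^-[0]$, $0\le i_s\le n-1$, $\mathsf x_s\in\mathbb{C}^\times$, $\gamma_s=1$ if $i_s\ne0$, $\gamma_s\in\{\pm1\}$ if $i_s=0$, $\mu^\pm\in\Lambda^+$; $\lambda=\sum_s\gamma_s\varpi_{i_s}$, $\lambda_{\mathsf x}=\sum_{s:\mathsf x_s=\mathsf x}\gamma_s\varpi_{i_s}$. Integrality assumption: $\lambda+\mu^++\mu^-=\sum_{i=1}^{n-1}a_i\alpha_i$, $a_i\in\mathbb{Z}_{\ge0}$;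 $a_0=a_n=0$. $\widetilde{\mathcal A}^v$: the $\mathbb{C}[v,v^{-1}]$-algebra generated by $D_{i,r}^{\pm1},\mathsf w_{i,r}^{\pm1/2},(\mathsf w_{i,r}-v^m\mathsf w_{i,s})^{-1},(1-v^l)^{-1}$ ($1\le i<n$, $1\le r\ne s\le a_i$, $m\in\mathbb{Z}$, $l\ne0$) with $D_{i,r}\mathsf w^{1/2}_{j,s}=v^{\delta_{ij}\delta_{rs}}\mathsf w^{1/2}_{j,s}D_{i,r}$, $D$'s commuting, $\mathsf w^{1/2}$'s commuting, obvious inverse relations; $\mathsf w_{i,r}=(\mathsf w^{1/2}_{i,r})^2$. $\mathsf Z_i(z)=\prod_{s:i_s=i}(1-v^{-i}\mathsf x_s/z)^{\gamma_s}$, $\mathsf W_j(z)=\prod_{r=1}^{a_j}(1-\mathsf w_{j,r}/z)$, $\mathsf W_{j,r}(z)=\prod_{s\ne r}(1-\mathsf w_{j,s}/z)$, $\mathsf W_0=\mathsf W_n=1$. Trigonometric Lax matrix: an $n\times n$ matrix of rational functions of $z$ with coefficients in $\widetilde{\mathcal A}^v$, $T_D(z)_{\alpha\beta}=\sum_{i=1}^{\min(\alpha,\beta)}f^D_{\alpha i}(z)g^D_i(z)e^D_{i\beta}(z)$, $e^D_{ii}=f^D_{ii}=1$, where $g^D_i(z)=\prod_{t=1}^{a_i}\mathsf w_{i,t}^{-1/2}\prod_{t=1}^{a_{i-1}}\mathsf w_{i-1,t}^{1/2}\, z^{\epsilon^\vee_i(\mu^+)}\frac{\mathsf W_i(v^{-i}z)}{\mathsf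 W_{i-1}(v^{-i-1}z)}\prod_{\mathsf x\in\mathbb{C}^\times}(1-\mathsf x/z)^{-\epsilon^\vee_i(\lambda_{\mathsf x})}$; for $i<j$: $e^D_{ij}(z)=(-1)^{i-j+1}\prod_{t=1}^{a_{j-1}}\mathsf w_{j-1,t}\prod_{k=i}^{j-2}\prod_{t=1}^{a_k}\mathsf w_{k,t}^{1/2}\prod_{t=1}^{a_{i-1}}\mathsf w_{i-1,t}^{-1/2}\sum_{r_i,\dots,r_{j-1}}\frac{\prod_{k=i}^{j-1}(v^k\mathsf w_{k,r_k})^{-\alpha^\vee_k(\mu^+)}}{1-v^i\mathsf w_{i,r_i}/z}\cdot\frac{\mathsf W_{i-1}(v^{-1}\mathsf w_{i,r_i})\prod_{k=i}^{j-2}\mathsf W_{k,r_k}(v^{-1}\mathsf w_{k+1,r_{k+1}})}{\prod_{k=i}^{j-1}\mathsf W_{k,r_k}(\mathsf w_{k,r_k})}\prod_{k=i}^{j-1}\mathsf Z_k(\mathsf w_{k,r_k})\cdot\frac{\mathsf w_{i,r_i}}{\mathsf w_{j-1,r_{j-1}}}\prod_{k=i}^{j-1}D_{k,r_k}^{-1}$; $f^D_{ji}(z)=(-1)^{i-j+1}v^{i-j}\prod_{k=i+1}^j\prod_{t=1}^{a_k}\mathsf w_{k,t}^{-1/2}\sum_{r_i,\dots,r_{j-1}}\frac{1}{1-z/(v^{i+2}\mathsf w_{i,r_i})}\cdot\frac{\mathsf W_j(v\mathsf w_{j-1,r_{j-1}})\prod_{k=i+1}^{j-1}\mathsf W_{k,r_k}(v\mathsf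 w_{k-1,r_{k-1}})}{\prod_{k=i}^{j-1}\mathsf W_{k,r_k}(\mathsf w_{k,r_k})}\cdot\frac{\mathsf w_{j-1,r_{j-1}}}{\mathsf w_{i,r_i}}\prod_{k=i}^{j-1}D_{k,r_k}$ (sums over $1\le r_k\le a_k$). *)

theory Defs
  imports Complex_Main "HOL-Library.Poly_Mapping" "HOL-Library.Product_Lexorder"
    "HOL-Library.FuncSet" "HOL-Computational_Algebra.Fraction_Field"
begin

text \<open>Formal variables: v, the spectral parameter z, and u_{i,r} = w^{1/2}_{i,r}.\<close>
datatype tvar = Vv | Zv | Uv nat nat

fun tvar_enc :: "tvar \<Rightarrow> nat \<times> nat \<times> nat" where
  "tvar_enc Vv = (0, 0, 0)"
| "tvar_enc Zv = (1, 0, 0)"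
| "tvar_enc (Uv i r) = (2, i, r)"

lemma inj_tvar_enc: "inj tvar_enc"
proof (rule injI)
  fix x y assume "tvar_enc x = tvar_enc y" then show "x = y"
    by (cases x; cases y) auto
qed

instantiation tvar :: linorder
begin
definition less_eq_tvar :: "tvar \<Rightarrow> tvar \<Rightarrow> bool" where
  "less_eq_tvar x y \<longleftrightarrow> tvar_enc x \<le> tvar_enc y"
definition less_tvar :: "tvar \<Rightarrow> tvar \<Rightarrow> bool" where
  "less_tvar x y \<longleftrightarrow> tvar_enc x < tvar_enc y"
instance
proof
  fix x y z :: tvar
  show "x < y \<longleftrightarrow> x \<le> y \<and> \<not> y \<le> x" by (auto simp: less_eq_tvar_def less_tvar_def)
  show "x \<le> x" by (simp add: less_eq_tvar_def)
  show "x \<le> y \<Longrightarrow> y \<le> z \<Longrightarrow> x \<le> z" by (auto simp: less_eq_tvar_def)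
  show "x \<le> y \<Longrightarrow> y \<le> x \<Longrightarrow> x = y"
    using inj_tvar_enc by (auto simp: less_eq_tvar_def inj_eq)
  show "x \<le> y \<or> y \<le> x" by (auto simp: less_eq_tvar_def)
qed
end

type_synonym LP = "(tvar \<Rightarrow>\<^sub>0 int) \<Rightarrow>\<^sub>0 complex"
type_synonym K = "LP fract"

definition constK :: "complex \<Rightarrow> K" where
  "constK c = Fract (Poly_Mapping.single 0 c) 1"

definition varK :: "tvar \<Rightarrow> K" where
  "varK x = Fract (Poly_Mapping.single (Poly_Mapping.single x 1) 1) 1"

abbreviation vK :: K where "vK \<equiv> varK Vv"
abbreviation zK :: K where "zK \<equiv> varK Zv"
abbreviation uK :: "nat \<Rightarrow> nat \<Rightarrow> K" where "uK i r \<equiv> varK (Uv i r)"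
abbreviation wK :: "nat \<Rightarrow> nat \<Rightarrow> K" where "wK i r \<equiv> (uK i r) ^ 2"

text \<open>The automorphism sigma^d of K (d = exponent vector of a D-monomial):
  u_{i,r} \<mapsto> v^{d(i,r)} u_{i,r}, all other variables fixed.  It encodes
  D^d c = sigma^d(c) D^d, i.e. D_{i,r} w^{1/2}_{i,r} = v w^{1/2}_{i,r} D_{i,r}.\<close>
fun sigma_var :: "(nat \<times> nat \<Rightarrow>\<^sub>0 int) \<Rightarrow> tvar \<Rightarrow> K" where
  "sigma_var d (Uv i r) = vK powi (Poly_Mapping.lookup d (i, r)) * uK i r"
| "sigma_var d x = varK x"

definition substLP :: "(nat \<times> nat \<Rightarrow>\<^sub>0 int) \<Rightarrow> LP \<Rightarrow> K" where
  "substLP d p = (\<Sum>m\<in>Poly_Mapping.keys p. constK (Poly_Mapping.lookup p m) *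
       (\<Prod>x\<in>Poly_Mapping.keys m. sigma_var d x powi (Poly_Mapping.lookup m x)))"

definition sigmaK :: "(nat \<times> nat \<Rightarrow>\<^sub>0 int) \<Rightarrow> K \<Rightarrow> K" where
  "sigmaK d q = (let (p1, p2) = (SOME (p1, p2). p2 \<noteq> 0 \<and> q = Fract p1 p2)
                 in substLP d p1 / substLP d p2)"

text \<open>Elements are normal-ordered finite sums  sum_d c_d D^d  (c_d in K, D^d a Laurent
  monomial in the D_{i,r}); multiplication uses D^d c = sigma^d(c) D^d.\<close>
type_synonym QA = "(nat \<times> nat \<Rightarrow>\<^sub>0 int) \<Rightarrow>\<^sub>0 K"

definition qmul :: "QA \<Rightarrow> QA \<Rightarrow> QA" where
  "qmul a b = (\<Sum>j\<in>Poly_Mapping.keys a. \<Sum>l\<in>Poly_Mapping.keys b.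
       Poly_Mapping.single (j + l) (Poly_Mapping.lookup a j * sigmaK j (Poly_Mapping.lookup b l)))"

definition qsc :: "K \<Rightarrow> QA" where
  "qsc c = Poly_Mapping.single 0 c"

inductive_set Rset :: "nat \<Rightarrow> (nat \<Rightarrow> nat) \<Rightarrow> K set" for n :: nat and a :: "nat \<Rightarrow> nat" where
  R_const: "constK c \<in> Rset n a"
| R_v: "vK \<in> Rset n a"
| R_vinv: "inverse vK \<in> Rset n a"
| R_u: "\<lbrakk>1 \<le> i; i < n; 1 \<le> r; r \<le> a i\<rbrakk> \<Longrightarrow> uK i r \<in> Rset n a"
| R_uinv: "\<lbrakk>1 \<le> i; i < n; 1 \<le> r; r \<le> a i\<rbrakk> \<Longrightarrow> inverse (uK i r) \<in> Rset n a"
| R_loc: "\<lbrakk>1 \<le> i; i < n; 1 \<le> r; r \<le> a i; 1 \<le> s; s \<le> a i; r \<noteq> s\<rbrakk>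
            \<Longrightarrow> inverse (wK i r - vK powi m * wK i s) \<in> Rset n a"
| R_cyc: "l \<noteq> 0 \<Longrightarrow> inverse (1 - vK powi l) \<in> Rset n a"
| R_add: "\<lbrakk>x \<in> Rset n a; y \<in> Rset n a\<rbrakk> \<Longrightarrow> x + y \<in> Rset n a"
| R_mult: "\<lbrakk>x \<in> Rset n a; y \<in> Rset n a\<rbrakk> \<Longrightarrow> x * y \<in> Rset n a"

inductive_set Rzset :: "nat \<Rightarrow> (nat \<Rightarrow> nat) \<Rightarrow> K set" for n :: nat and a :: "nat \<Rightarrow> nat" where
  Rz_R: "x \<in> Rset n a \<Longrightarrow> x \<in> Rzset n a"
| Rz_z: "zK \<in> Rzset n a"
| Rz_add: "\<lbrakk>x \<in> Rzset n a; y \<in> Rzset n a\<rbrakk> \<Longrightarrow> x + y \<in> Rzset n a"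
| Rz_mult: "\<lbrakk>x \<in> Rzset n a; y \<in> Rzset n a\<rbrakk> \<Longrightarrow> x * y \<in> Rzset n a"

definition in_Atz :: "nat \<Rightarrow> (nat \<Rightarrow> nat) \<Rightarrow> QA \<Rightarrow> bool" where
  "in_Atz n a q \<longleftrightarrow> (\<forall>d\<in>Poly_Mapping.keys q.
      Poly_Mapping.keys d \<subseteq> {(i, r). 1 \<le> i \<and> i < n \<and> 1 \<le> r \<and> r \<le> a i} \<and> Poly_Mapping.lookup q d \<in> Rzset n a)"

text \<open>Weights in Lambda = Z^n are functions nat \<Rightarrow> int; coordinate j (1 \<le> j \<le> n) is eps_j^vee.\<close>
definition varpi :: "nat \<Rightarrow> nat \<Rightarrow> int" where
  "varpi i = (\<lambda>j. if i < j then -1 else 0)"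

definition alpha :: "nat \<Rightarrow> nat \<Rightarrow> int" where
  "alpha i = (\<lambda>j. (if j = i then 1 else 0) - (if j = Suc i then 1 else 0))"

definition alphav :: "nat \<Rightarrow> (nat \<Rightarrow> int) \<Rightarrow> int" where
  "alphav i \<nu> = \<nu> i - \<nu> (Suc i)"

definition dominant :: "nat \<Rightarrow> (nat \<Rightarrow> int) \<Rightarrow> bool" where
  "dominant n \<nu> \<longleftrightarrow> (\<forall>i\<in>{1..<n}. alphav i \<nu> \<ge> 0)"

text \<open>Divisor D = sum_{s=1}^N gam_s varpi_{is_s}[xs_s] + mup[\<infinity>] + mum[0].\<close>
definition trig_divisor :: "nat \<Rightarrow> nat \<Rightarrow> (nat \<Rightarrow> nat) \<Rightarrow> (nat \<Rightarrow> complex) \<Rightarrow> (nat \<Rightarrow> int)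
    \<Rightarrow> (nat \<Rightarrow> int) \<Rightarrow> (nat \<Rightarrow> int) \<Rightarrow> bool" where
  "trig_divisor n N is xs gam mup mum \<longleftrightarrow>
     (\<forall>s\<in>{1..N}. is s \<le> n - 1 \<and> xs s \<noteq> 0 \<and>
         (is s \<noteq> 0 \<longrightarrow> gam s = 1) \<and> (is s = 0 \<longrightarrow> gam s \<in> {1, -1}))
     \<and> dominant n mup \<and> dominant n mum"

definition lam :: "nat \<Rightarrow> (nat \<Rightarrow> nat) \<Rightarrow> (nat \<Rightarrow> int) \<Rightarrow> nat \<Rightarrow> int" where
  "lam N is gam = (\<lambda>j. \<Sum>s=1..N. gam s * varpi (is s) j)"

definition lamx :: "nat \<Rightarrow> (nat \<Rightarrow> nat) \<Rightarrow> (nat \<Rightarrow> complex) \<Rightarrow> (nat \<Rightarrow> int) \<Rightarrow> complex \<Rightarrow> nat \<Rightarrow> int" where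
  "lamx N is xs gam x = (\<lambda>j. \<Sum>s\<in>{s\<in>{1..N}. xs s = x}. gam s * varpi (is s) j)"

definition integrality :: "nat \<Rightarrow> nat \<Rightarrow> (nat \<Rightarrow> nat) \<Rightarrow> (nat \<Rightarrow> int)
    \<Rightarrow> (nat \<Rightarrow> int) \<Rightarrow> (nat \<Rightarrow> int) \<Rightarrow> (nat \<Rightarrow> nat) \<Rightarrow> bool" where
  "integrality n N is gam mup mum a \<longleftrightarrow>
     a 0 = 0 \<and> a n = 0 \<and>
     (\<forall>j\<in>{1..n}. lam N is gam j + mup j + mum j = (\<Sum>i=1..<n. int (a i) * alpha i j))"

definition ZZ :: "nat \<Rightarrow> (nat \<Rightarrow> nat) \<Rightarrow> (nat \<Rightarrow> complex) \<Rightarrow> (nat \<Rightarrow> int) \<Rightarrow> nat \<Rightarrow> K \<Rightarrow> K" where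
  "ZZ N is xs gam i y = (\<Prod>s\<in>{s\<in>{1..N}. is s = i}.
        (1 - vK powi (- int i) * constK (xs s) / y) powi gam s)"

definition WW :: "(nat \<Rightarrow> nat) \<Rightarrow> nat \<Rightarrow> K \<Rightarrow> K" where
  "WW a j y = (\<Prod>r=1..a j. 1 - wK j r / y)"

definition WWr :: "(nat \<Rightarrow> nat) \<Rightarrow> nat \<Rightarrow> nat \<Rightarrow> K \<Rightarrow> K" where
  "WWr a j r y = (\<Prod>t\<in>{1..a j} - {r}. 1 - wK j t / y)"

definition laxg :: "nat \<Rightarrow> (nat \<Rightarrow> nat) \<Rightarrow> (nat \<Rightarrow> complex) \<Rightarrow> (nat \<Rightarrow> int) \<Rightarrow> (nat \<Rightarrow> int)
    \<Rightarrow> (nat \<Rightarrow> nat) \<Rightarrow> nat \<Rightarrow> K" where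
  "laxg N is xs gam mup a i =
     inverse (\<Prod>t=1..a i. uK i t) * (\<Prod>t=1..a (i - 1). uK (i - 1) t)
     * zK powi (mup i)
     * WW a i (vK powi (- int i) * zK) / WW a (i - 1) (vK powi (- int i - 1) * zK)
     * (\<Prod>x\<in>xs ` {1..N}. (1 - constK x / zK) powi (- lamx N is xs gam x i))"

definition Dexp :: "nat \<Rightarrow> nat \<Rightarrow> (nat \<Rightarrow> nat) \<Rightarrow> (nat \<times> nat \<Rightarrow>\<^sub>0 int)" where
  "Dexp i j r = (\<Sum>k=i..<j. Poly_Mapping.single (k, r k) 1)"

definition laxe :: "nat \<Rightarrow> (nat \<Rightarrow> nat) \<Rightarrow> (nat \<Rightarrow> complex) \<Rightarrow> (nat \<Rightarrow> int) \<Rightarrow> (nat \<Rightarrow> int)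
    \<Rightarrow> (nat \<Rightarrow> nat) \<Rightarrow> nat \<Rightarrow> nat \<Rightarrow> QA" where
  "laxe N is xs gam mup a i j =
    (if j = i then qsc 1 else if j < i then 0 else
     (\<Sum>r\<in>(\<Pi>\<^sub>E k\<in>{i..<j}. {1..a k}).
       Poly_Mapping.single (- Dexp i j r)
        ((-1) powi (int i - int j + 1)
         * (\<Prod>t=1..a (j - 1). wK (j - 1) t)
         * (\<Prod>k=i..j - 2. \<Prod>t=1..a k. uK k t)
         * inverse (\<Prod>t=1..a (i - 1). uK (i - 1) t)
         * (\<Prod>k=i..<j. (vK ^ k * wK k (r k)) powi (- alphav k mup))
         / (1 - vK ^ i * wK i (r i) / zK)
         * WW a (i - 1) (inverse vK * wK i (r i))
         * (\<Prod>k=i..j - 2. WWr a k (r k) (inverse vK * wK (k + 1) (r (k + 1))))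
         / (\<Prod>k=i..<j. WWr a k (r k) (wK k (r k)))
         * (\<Prod>k=i..<j. ZZ N is xs gam k (wK k (r k)))
         * wK i (r i) / wK (j - 1) (r (j - 1)))))"

definition laxf :: "(nat \<Rightarrow> nat) \<Rightarrow> nat \<Rightarrow> nat \<Rightarrow> QA" where
  "laxf a j i =
    (if j = i then qsc 1 else if j < i then 0 else
     (\<Sum>r\<in>(\<Pi>\<^sub>E k\<in>{i..<j}. {1..a k}).
       Poly_Mapping.single (Dexp i j r)
        ((-1) powi (int i - int j + 1) * vK powi (int i - int j)
         * inverse (\<Prod>k=i+1..j. \<Prod>t=1..a k. uK k t)
         / (1 - zK / (vK ^ (i + 2) * wK i (r i)))
         * WW a j (vK * wK (j - 1) (r (j - 1)))
         * (\<Prod>k=i+1..<j. WWr a k (r k) (vK * wK (k - 1) (r (k - 1))))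
         / (\<Prod>k=i..<j. WWr a k (r k) (wK k (r k)))
         * wK (j - 1) (r (j - 1)) / wK i (r i))))"

definition laxT :: "nat \<Rightarrow> (nat \<Rightarrow> nat) \<Rightarrow> (nat \<Rightarrow> complex) \<Rightarrow> (nat \<Rightarrow> int) \<Rightarrow> (nat \<Rightarrow> int)
    \<Rightarrow> (nat \<Rightarrow> nat) \<Rightarrow> nat \<Rightarrow> nat \<Rightarrow> QA" where
  "laxT N is xs gam mup a \<alpha> \<beta> =
     (\<Sum>i=1..min \<alpha> \<beta>. qmul (qmul (laxf a \<alpha> i) (qsc (laxg N is xs gam mup a i)))
                              (laxe N is xs gam mup a i \<beta>))"

definition laxTn :: "nat \<Rightarrow> (nat \<Rightarrow> nat) \<Rightarrow> (nat \<Rightarrow> complex) \<Rightarrow> (nat \<Rightarrow> int) \<Rightarrow> (nat \<Rightarrow> int)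
    \<Rightarrow> (nat \<Rightarrow> int) \<Rightarrow> (nat \<Rightarrow> nat) \<Rightarrow> nat \<Rightarrow> nat \<Rightarrow> QA" where
  "laxTn N is xs gam mup mum a \<alpha> \<beta> =
     qmul (qsc (zK powi (lam N is gam 1 + mum 1) * inverse (ZZ N is xs gam 0 zK)))
          (laxT N is xs gam mup a \<alpha> \<beta>)"

end

(* In the normal-ordered expansion, the summand of T(z)_{alpha beta} indexed by i and by the tuples
   r, r' contributes to the monomial D^d, d = sum_k (k, r_k) - sum_k (k, r'_k).  After commuting the
   D's to the right, the numerator W_i(v^{-i} z) of g_i, shifted by the D's of f, cancels the pole of
   f, and (when r_i and r'_i differ) also that of e.  By integrality the total power of z is
   mum_1 - mum_i (plus 1 if i < beta), nonnegative by dominance of mum.  The coefficient thus has at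
   most simple poles at v^(i+1) w_{i-1,t}, coming from W_{i-1}, and, when r_i = r'_i, one at
   v^(i+2) w_{i,r_i}.  The residue of (i; r, r') at v^(i+1) w_{i-1,t} is the negative of that of
   (i-1; (t,r), (t,r')), which contributes to the same monomial, so all poles cancel in the sum. *)

theory Submission
  imports Defs "HOL-Computational_Algebra.Polynomial"
begin

text \<open>Cancelling residues inside the field \<open>K\<close> would only yield polynomials in z
  over \<open>K\<close>, while the coefficients must lie in \<open>Rset n a\<close>, where only
  certain denominators are available. Each summand is therefore split by partial fractions over that
  subring; only the polynomial part has to have coefficients there, and the residues are mere
  elements of \<open>K\<close> that cancel. Differences of the points v^(i+1) w_{i-1,t}, all at one
  level i-1, have inverses in \<open>Rset n a\<close>, but no generator inverts a difference between
  levels i-1 and i. Such differences become denominators when r_i = r'_i, where poles of both levels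
  meet; the factor W_{i-1} of e supplies the product that compensates for them. The matching of
  residues telescopes in i. At i = 1 there is no pole from W_0 since a_0 = 0, and at i = min(alpha,
  beta) one of f, e is the diagonal entry 1, so no pole is left at v^(i+2) w_{i,r_i}. Since
  \<open>sigmaK\<close> is defined through an arbitrary choice of fraction, even its compatibility
  with sums and products needs proof.\<close>

lemma poly_mapping_sum_single:
  assumes "finite A" "Poly_Mapping.keys p \<subseteq> A"
  shows "(\<Sum>k\<in>A. Poly_Mapping.single k (Poly_Mapping.lookup p k)) = p"
proof (rule poly_mapping_eqI)
  fix k
  have "Poly_Mapping.lookup (\<Sum>k\<in>A. Poly_Mapping.single k (Poly_Mapping.lookup p k)) k
      = (\<Sum>l\<in>A. if l = k then Poly_Mapping.lookup p l else 0)"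
    by (auto simp: lookup_sum lookup_single when_def intro!: sum.cong)
  also have "\<dots> = Poly_Mapping.lookup p k"
    using assms by (auto simp: sum.delta in_keys_iff)
  finally show "Poly_Mapping.lookup (\<Sum>k\<in>A. Poly_Mapping.single k (Poly_Mapping.lookup p k)) k
      = Poly_Mapping.lookup p k" .
qed

lemma sum_keys_superset:
  assumes "finite A" "Poly_Mapping.keys p \<subseteq> A" "\<And>k. h k 0 = 0"
  shows "(\<Sum>k\<in>Poly_Mapping.keys p. h k (Poly_Mapping.lookup p k))
       = (\<Sum>k\<in>A. h k (Poly_Mapping.lookup p k))"
  by (rule sum.mono_neutral_left) (use assms in \<open>auto simp: in_keys_iff\<close>)

section \<open>The automorphisms sigma\<close>

definition LPK :: "LP \<Rightarrow> K" where "LPK p = Fract p 1"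

lemma LPK_simps [simp]:
  "LPK 0 = 0" "LPK 1 = 1" "LPK (p + q) = LPK p + LPK q" "LPK (p * q) = LPK p * LPK q"
  by (simp_all add: LPK_def Zero_fract_def One_fract_def)

lemma LPK_eq_iff: "LPK p = LPK q \<longleftrightarrow> p = q"
  by (simp add: LPK_def eq_fract)

lemma LPK_sum: "LPK (sum f A) = (\<Sum>x\<in>A. LPK (f x))"
  by (induction A rule: infinite_finite_induct) auto

lemma Fract_eq_LPK: "q \<noteq> 0 \<Longrightarrow> Fract p q = LPK p / LPK q"
  by (simp add: LPK_def)

definition monK :: "(tvar \<Rightarrow>\<^sub>0 int) \<Rightarrow> K" where
  "monK m = LPK (Poly_Mapping.single m 1)"

lemma monK_0 [simp]: "monK 0 = 1"
  by (simp add: monK_def)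

lemma monK_add: "monK (m + m') = monK m * monK m'"
  by (simp add: monK_def mult_single flip: LPK_simps)

lemma monK_nonzero [simp]: "monK m \<noteq> 0"
  by (metis mult_zero_left monK_0 monK_add right_minus zero_neq_one)

text \<open>Every later statement that two roots or poles are different is reduced by this to a
  comparison of exponents.\<close>

lemma monK_eq_iff: "monK m = monK m' \<longleftrightarrow> m = m'"
  by (auto simp: monK_def LPK_eq_iff dest: arg_cong[where f = Poly_Mapping.keys])

lemma monK_uminus: "monK (- m) = inverse (monK m)"
  by (metis monK_0 monK_add inverse_unique right_minus)

lemma varK_eq_monK: "varK x = monK (Poly_Mapping.single x 1)"
  by (simp add: varK_def monK_def LPK_def)

lemma varK_nonzero [simp]: "varK x \<noteq> 0"
  by (simp add: varK_eq_monK)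

lemma constK_eq_LPK: "constK c = LPK (Poly_Mapping.single 0 c)"
  by (simp add: constK_def LPK_def)

lemma constK_0 [simp]: "constK 0 = 0" and constK_1 [simp]: "constK 1 = 1"
  and constK_uminus: "constK (- c) = - constK c"
  by (simp_all add: constK_def Zero_fract_def One_fract_def single_uminus)

lemma monK_single_powi: "monK (Poly_Mapping.single x k) = varK x powi k"
proof -
  have nat: "monK (Poly_Mapping.single x (int m)) = varK x ^ m" for m
    by (induction m) (simp_all add: varK_eq_monK single_add monK_add)
  show ?thesis
  proof (cases k)
    case (nonneg m)
    then show ?thesis by (simp add: nat)
  next
    case (neg m)
    then show ?thesis
      by (simp add: single_uminus monK_uminus nat power_int_minus del: of_nat_Suc)
  qed
qed

lemma monK_sum: "monK (sum f A) = (\<Prod>x\<in>A. monK (f x))"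
  by (induction A rule: infinite_finite_induct) (auto simp: monK_add)

text \<open>The power of v created when the D-monomial with exponent \<open>d\<close> is moved past
  the monomial with exponent \<open>m\<close>: the pairing of \<open>d\<close> with the exponents of
  the u-variables.\<close>

definition vdeg :: "(nat \<times> nat \<Rightarrow>\<^sub>0 int) \<Rightarrow> (tvar \<Rightarrow>\<^sub>0 int) \<Rightarrow> int" where
  "vdeg d m = (\<Sum>x\<in>Poly_Mapping.keys m.
     (case x of Uv i r \<Rightarrow> Poly_Mapping.lookup d (i, r) | _ \<Rightarrow> 0) * Poly_Mapping.lookup m x)"

text \<open>On exponents, \<open>sigmaK d\<close> acts by \<open>shiftm d\<close>; injectivity of the latter makes
  \<open>sigmaK\<close> well defined on fractions.\<close>

definition shiftm :: "(nat \<times> nat \<Rightarrow>\<^sub>0 int) \<Rightarrow> (tvar \<Rightarrow>\<^sub>0 int) \<Rightarrow> (tvar \<Rightarrow>\<^sub>0 int)" where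
  "shiftm d m = m + Poly_Mapping.single Vv (vdeg d m)"

lemma vdeg_add: "vdeg d (m + m') = vdeg d m + vdeg d m'"
proof -
  let ?A = "Poly_Mapping.keys m \<union> Poly_Mapping.keys m'"
  let ?h = "\<lambda>x k. (case x of Uv i r \<Rightarrow> Poly_Mapping.lookup d (i, r) | _ \<Rightarrow> 0) * (k :: int)"
  have *: "vdeg d p = (\<Sum>x\<in>?A. ?h x (Poly_Mapping.lookup p x))" if "Poly_Mapping.keys p \<subseteq> ?A" for p
    unfolding vdeg_def by (rule sum_keys_superset) (use that in auto)
  show ?thesis
    using keys_add[of m m'] by (simp add: * lookup_add distrib_left sum.distrib)
qed

lemma vdeg_single_Vv [simp]: "vdeg d (Poly_Mapping.single Vv k) = 0"
  by (simp add: vdeg_def)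

lemma shiftm_add: "shiftm d (m + m') = shiftm d m + shiftm d m'"
  by (simp add: shiftm_def vdeg_add single_add algebra_simps)

text \<open>The shift adds only a power of \<open>Vv\<close>, on which \<open>vdeg d\<close>
  vanishes; so \<open>vdeg d\<close> can be read off the image and the shift undone.\<close>

lemma shiftm_inj: "shiftm d m = shiftm d m' \<longleftrightarrow> m = m'"
proof
  assume eq: "shiftm d m = shiftm d m'"
  then have "vdeg d (shiftm d m) = vdeg d (shiftm d m')" by simp
  then have "vdeg d m = vdeg d m'" by (simp add: shiftm_def vdeg_add)
  with eq show "m = m'" by (simp add: shiftm_def)
qed simp

lemma sigma_var_powi: "sigma_var d x powi k = monK (Poly_Mapping.single x k
    + Poly_Mapping.single Vv ((case x of Uv i r \<Rightarrow> Poly_Mapping.lookup d (i, r) | _ \<Rightarrow> 0) * k))"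
  by (cases x) (simp_all add: monK_add monK_single_powi power_int_mult_distrib
      flip: power_int_mult)

lemma prod_sigma_var:
  "(\<Prod>x\<in>Poly_Mapping.keys m. sigma_var d x powi (Poly_Mapping.lookup m x)) = monK (shiftm d m)"
proof -
  have single_sum: "(\<Sum>x\<in>A. Poly_Mapping.single Vv (f x)) = Poly_Mapping.single Vv (sum f A)"
    for A and f :: "tvar \<Rightarrow> int"
    by (induction A rule: infinite_finite_induct) (auto simp: single_add)
  show ?thesis
    by (simp add: sigma_var_powi flip: monK_sum)
      (simp add: sum.distrib poly_mapping_sum_single shiftm_def vdeg_def single_sum)
qed

lemma constK_mult_monK: "constK c * monK m = LPK (Poly_Mapping.single m c)"
  by (simp add: constK_eq_LPK monK_def mult_single flip: LPK_simps)

text \<open>The index set may exceed the support, so that two Laurent polynomials and their sum can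
  be expanded over the same set.\<close>

lemma substLP_eq:
  assumes "finite A" "Poly_Mapping.keys p \<subseteq> A"
  shows "substLP d p
    = LPK (\<Sum>m\<in>A. Poly_Mapping.single (shiftm d m) (Poly_Mapping.lookup p m))"
proof -
  have "substLP d p = LPK (\<Sum>m\<in>Poly_Mapping.keys p.
      Poly_Mapping.single (shiftm d m) (Poly_Mapping.lookup p m))"
    by (simp add: substLP_def prod_sigma_var constK_mult_monK LPK_sum)
  also have "\<dots> = LPK (\<Sum>m\<in>A. Poly_Mapping.single (shiftm d m) (Poly_Mapping.lookup p m))"
    using sum_keys_superset[of A p "\<lambda>m. Poly_Mapping.single (shiftm d m)"] assms by simp
  finally show ?thesis .
qed

lemma substLP_0 [simp]: "substLP d 0 = 0"
  by (simp add: substLP_def)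

lemma substLP_single: "substLP d (Poly_Mapping.single m c) = LPK (Poly_Mapping.single (shiftm d m) c)"
  by (subst substLP_eq[of "{m}"]) auto

lemma substLP_add: "substLP d (p + q) = substLP d p + substLP d q"
proof -
  let ?A = "Poly_Mapping.keys p \<union> Poly_Mapping.keys q"
  show ?thesis
    using keys_add[of p q]
    by (simp add: substLP_eq[of ?A] lookup_add single_add sum.distrib flip: LPK_simps)
qed

lemma substLP_sum: "substLP d (sum f A) = (\<Sum>x\<in>A. substLP d (f x))"
  by (induction A rule: infinite_finite_induct) (auto simp: substLP_add)

lemma substLP_mult: "substLP d (p * q) = substLP d p * substLP d q"
proof -
  let ?s = "\<lambda>p m. Poly_Mapping.single m (Poly_Mapping.lookup p m)"
  have p: "p = sum (?s p) (Poly_Mapping.keys p)" for p :: LP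
    by (simp add: poly_mapping_sum_single)
  have "substLP d (?s p m * ?s q m') = substLP d (?s p m) * substLP d (?s q m')" for m m'
    by (simp add: mult_single substLP_single shiftm_add flip: LPK_simps)
  then have "substLP d (sum (?s p) (Poly_Mapping.keys p) * sum (?s q) (Poly_Mapping.keys q))
      = substLP d (sum (?s p) (Poly_Mapping.keys p)) * substLP d (sum (?s q) (Poly_Mapping.keys q))"
    by (simp add: sum_product substLP_sum)
  then show ?thesis
    using p[of p] p[of q] by simp
qed

text \<open>By injectivity of \<open>shiftm d\<close> no two terms of \<open>p\<close> merge, so
  each coefficient of \<open>p\<close> is still visible in the image. This keeps denominators
  nonzero under the substitution.\<close>

lemma substLP_eq_0_iff [simp]: "substLP d p = 0 \<longleftrightarrow> p = 0"
proof
  assume "substLP d p = 0"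
  then have eq: "(\<Sum>m\<in>Poly_Mapping.keys p. Poly_Mapping.single (shiftm d m) (Poly_Mapping.lookup p m)) = 0"
    using substLP_eq[of "Poly_Mapping.keys p" p d] LPK_eq_iff[of _ 0] by simp
  show "p = 0"
  proof (rule poly_mapping_eqI)
    fix k
    have "Poly_Mapping.lookup (\<Sum>m\<in>Poly_Mapping.keys p.
          Poly_Mapping.single (shiftm d m) (Poly_Mapping.lookup p m)) (shiftm d k)
        = (\<Sum>m\<in>Poly_Mapping.keys p. if m = k then Poly_Mapping.lookup p m else 0)"
      by (auto simp: lookup_sum lookup_single when_def shiftm_inj intro!: sum.cong)
    also have "\<dots> = Poly_Mapping.lookup p k"
      by (auto simp: sum.delta in_keys_iff)
    finally show "Poly_Mapping.lookup p k = Poly_Mapping.lookup 0 k"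
      by (simp add: eq)
  qed
qed simp

lemma substLP_1 [simp]: "substLP d 1 = 1"
  using substLP_single[of d 0 1] by (simp add: shiftm_def vdeg_def)

text \<open>Independence of the fraction picked by \<open>SOME\<close>: cross-multiplied equality of
  two fractions is preserved by the multiplicative map \<open>substLP d\<close>, and the
  denominators do not become 0.\<close>

lemma sigmaK_Fract:
  assumes "q \<noteq> 0"
  shows "sigmaK d (Fract p q) = substLP d p / substLP d q"
proof -
  define P where "P = (\<lambda>(p1, p2). p2 \<noteq> (0 :: LP) \<and> Fract p q = Fract p1 p2)"
  obtain p1 p2 where pp: "(SOME x. P x) = (p1, p2)" by fastforce
  have "P (p, q)" using assms by (simp add: P_def)
  then have "P (SOME x. P x)" by (rule someI)
  then have P: "p2 \<noteq> 0" "Fract p q = Fract p1 p2"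
    by (simp_all add: pp) (auto simp: P_def)
  then have "p * p2 = p1 * q"
    using assms by (simp add: eq_fract)
  then have "substLP d p * substLP d p2 = substLP d p1 * substLP d q"
    by (metis substLP_mult)
  moreover have "sigmaK d (Fract p q) = substLP d p1 / substLP d p2"
    using pp by (simp add: sigmaK_def P_def)
  ultimately show ?thesis
    using P assms by (simp add: frac_eq_eq)
qed

lemma sigmaK_0 [simp]: "sigmaK d 0 = 0" and sigmaK_1 [simp]: "sigmaK d 1 = 1"
  using sigmaK_Fract[of 1 d 0] sigmaK_Fract[of 1 d 1]
  by (simp_all flip: Zero_fract_def One_fract_def)

lemma sigmaK_add: "sigmaK d (x + y) = sigmaK d x + sigmaK d y"
  by (cases x; cases y) (simp add: sigmaK_Fract substLP_add substLP_mult field_simps)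

lemma sigmaK_mult: "sigmaK d (x * y) = sigmaK d x * sigmaK d y"
  by (cases x; cases y) (simp add: sigmaK_Fract substLP_mult)

lemma sigmaK_uminus: "sigmaK d (- x) = - sigmaK d x"
  by (metis add_eq_0_iff sigmaK_0 sigmaK_add)

lemma sigmaK_diff: "sigmaK d (x - y) = sigmaK d x - sigmaK d y"
  by (metis diff_conv_add_uminus sigmaK_add sigmaK_uminus)

lemma sigmaK_inverse: "sigmaK d (inverse x) = inverse (sigmaK d x)"
  by (metis inverse_unique inverse_zero right_inverse sigmaK_0 sigmaK_1 sigmaK_mult)

lemma sigmaK_divide: "sigmaK d (x / y) = sigmaK d x / sigmaK d y"
  by (simp add: divide_inverse sigmaK_mult sigmaK_inverse)

lemma sigmaK_power: "sigmaK d (x ^ k) = sigmaK d x ^ k"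
  by (induction k) (auto simp: sigmaK_mult)

lemma sigmaK_power_int: "sigmaK d (x powi k) = sigmaK d x powi k"
  by (simp add: power_int_def sigmaK_power sigmaK_inverse)

lemma sigmaK_prod: "sigmaK d (prod f A) = (\<Prod>x\<in>A. sigmaK d (f x))"
  by (induction A rule: infinite_finite_induct) (auto simp: sigmaK_mult)

lemma sigmaK_constK [simp]: "sigmaK d (constK c) = constK c"
  by (simp add: constK_def sigmaK_Fract substLP_single shiftm_def vdeg_def LPK_def)

lemma sigmaK_varK: "sigmaK d (varK x) = sigma_var d x"
  using prod_sigma_var[of d "Poly_Mapping.single x 1"]
  by (simp add: varK_def sigmaK_Fract substLP_single monK_def)

lemma sigmaK_vK [simp]: "sigmaK d vK = vK" and sigmaK_zK [simp]: "sigmaK d zK = zK"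
  by (simp_all add: sigmaK_varK)

lemma sigmaK_wK: "sigmaK d (wK i r) = vK powi (2 * Poly_Mapping.lookup d (i, r)) * wK i r"
  by (simp add: sigmaK_varK sigmaK_power power_mult_distrib mult.commute[of 2]
      power_int_mult)

lemmas sigmaK_hom = sigmaK_add sigmaK_mult sigmaK_uminus sigmaK_diff sigmaK_inverse
  sigmaK_divide sigmaK_power sigmaK_power_int sigmaK_prod

lemma shiftm_0: "shiftm 0 m = m"
proof -
  have "(case x of Uv i r \<Rightarrow> Poly_Mapping.lookup (0 :: nat \<times> nat \<Rightarrow>\<^sub>0 int) (i, r) | _ \<Rightarrow> 0) = (0 :: int)" for x
    by (cases x) auto
  then show ?thesis by (simp add: shiftm_def vdeg_def)
qed

lemma sigmaK_zero [simp]: "sigmaK 0 x = x"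
proof (cases x rule: Fract_cases)
  case (Fract p q)
  have "substLP 0 p = LPK p" for p
    using substLP_eq[of "Poly_Mapping.keys p" p 0]
    by (simp only: shiftm_0 poly_mapping_sum_single finite_keys order_refl)
  then show ?thesis
    using Fract sigmaK_Fract[of q 0 p] Fract_eq_LPK[of q p] by simp
qed

section \<open>Partial fractions over a subring of a field\<close>

text \<open>A set of polynomials over the ambient field, because the coefficient ring is a subset of
  \<open>K\<close> and not a type.\<close>

definition polys_over :: "'a::comm_ring_1 set \<Rightarrow> 'a poly set" where
  "polys_over S = {p. \<forall>k. coeff p k \<in> S}"

lemma pCons_polys_over_iff: "pCons c p \<in> polys_over S \<longleftrightarrow> c \<in> S \<and> p \<in> polys_over S"
proof -
  have "(\<forall>k. coeff (pCons c p) k \<in> S) \<longleftrightarrow> c \<in> S \<and> (\<forall>k. coeff p k \<in> S)"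
    by (auto simp: coeff_pCons split: nat.splits)
  then show ?thesis by (simp add: polys_over_def)
qed

text \<open>Abstracts \<open>Rset n a\<close>. Closure under inverses is not part of it, so every
  division below must exhibit the inverse it uses as an element of \<open>S\<close>.\<close>

locale field_subring =
  fixes S :: "'a::field set"
  assumes zero_closed [simp]: "0 \<in> S" and one_closed [simp]: "1 \<in> S"
    and add_closed: "x \<in> S \<Longrightarrow> y \<in> S \<Longrightarrow> x + y \<in> S"
    and uminus_closed: "x \<in> S \<Longrightarrow> - x \<in> S"
    and mult_closed: "x \<in> S \<Longrightarrow> y \<in> S \<Longrightarrow> x * y \<in> S"
begin

lemma diff_closed: "x \<in> S \<Longrightarrow> y \<in> S \<Longrightarrow> x - y \<in> S"
  using add_closed[of x "- y"] uminus_closed[of y] by simp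

lemma sum_closed: "(\<And>i. i \<in> I \<Longrightarrow> f i \<in> S) \<Longrightarrow> sum f I \<in> S"
  by (induction I rule: infinite_finite_induct) (auto intro: add_closed)

lemma prod_closed: "(\<And>i. i \<in> I \<Longrightarrow> f i \<in> S) \<Longrightarrow> prod f I \<in> S"
  by (induction I rule: infinite_finite_induct) (auto intro: mult_closed)

lemma power_closed: "x \<in> S \<Longrightarrow> x ^ k \<in> S"
  by (induction k) (auto intro: mult_closed)

lemma power_int_closed: "x \<in> S \<Longrightarrow> inverse x \<in> S \<Longrightarrow> x powi k \<in> S"
  by (simp add: power_int_def power_closed)

lemma inverse_prod_closed: "(\<And>i. i \<in> I \<Longrightarrow> inverse (f i) \<in> S) \<Longrightarrow> inverse (prod f I) \<in> S"
  by (simp add: prod_inversef[symmetric] o_def prod_closed)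

lemma divide_closed: "x \<in> S \<Longrightarrow> inverse y \<in> S \<Longrightarrow> x / y \<in> S"
  by (simp add: divide_inverse mult_closed)

lemma poly_closed: "p \<in> polys_over S \<Longrightarrow> x \<in> S \<Longrightarrow> poly p x \<in> S"
  by (auto simp: poly_altdef polys_over_def intro!: sum_closed mult_closed power_closed)

lemma polys_over_add: "p \<in> polys_over S \<Longrightarrow> q \<in> polys_over S \<Longrightarrow> p + q \<in> polys_over S"
  by (simp add: polys_over_def add_closed)

lemma polys_over_diff: "p \<in> polys_over S \<Longrightarrow> q \<in> polys_over S \<Longrightarrow> p - q \<in> polys_over S"
  by (simp add: polys_over_def diff_closed)

lemma polys_over_mult: "p \<in> polys_over S \<Longrightarrow> q \<in> polys_over S \<Longrightarrow> p * q \<in> polys_over S"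
  by (auto simp: polys_over_def coeff_mult intro!: sum_closed mult_closed)

lemma polys_over_0 [simp]: "0 \<in> polys_over S"
  by (simp add: polys_over_def)

lemma polys_over_const: "c \<in> S \<Longrightarrow> [:c:] \<in> polys_over S"
  by (simp add: pCons_polys_over_iff)

lemma polys_over_1 [simp]: "1 \<in> polys_over S"
  by (simp add: one_pCons polys_over_const)

lemma polys_over_linear: "c \<in> S \<Longrightarrow> [:- c, 1:] \<in> polys_over S"
  by (simp add: pCons_polys_over_iff uminus_closed)

lemma polys_over_monom: "monom 1 k \<in> polys_over S"
  by (simp add: polys_over_def)

lemma polys_over_smult: "c \<in> S \<Longrightarrow> p \<in> polys_over S \<Longrightarrow> smult c p \<in> polys_over S"
  by (simp add: polys_over_def mult_closed)

lemma polys_over_prod: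
  "(\<And>i. i \<in> I \<Longrightarrow> f i \<in> polys_over S) \<Longrightarrow> prod f I \<in> polys_over S"
  by (induction I rule: infinite_finite_induct) (auto intro: polys_over_mult)

lemma polys_over_sum:
  "(\<And>i. i \<in> I \<Longrightarrow> f i \<in> polys_over S) \<Longrightarrow> sum f I \<in> polys_over S"
  by (induction I rule: infinite_finite_induct) (auto intro: polys_over_add)

text \<open>The divisor is monic, so the Horner scheme only adds and multiplies.\<close>

lemma synthetic_div_closed:
  "p \<in> polys_over S \<Longrightarrow> c \<in> S \<Longrightarrow> synthetic_div p c \<in> polys_over S"
proof (induction p)
  case (pCons a p)
  then have "p \<in> polys_over S"
    by (simp add: pCons_polys_over_iff)
  with pCons show ?case
    by (simp add: pCons_polys_over_iff poly_closed)
qed simp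

lemma poly_remainder_closed:
  assumes "p \<in> polys_over S" "c \<in> S"
  obtains q where "q \<in> polys_over S" "p = [:- c, 1:] * q + [:poly p c:]"
  by (rule that[OF synthetic_div_closed[OF assms] synthetic_div_correct'[symmetric]])

text \<open>The roots are split off one at a time; being distinct from the removed root, each
  remaining one is a root of the quotient. All divisors are monic, so no inverse of a difference of
  roots has to lie in \<open>S\<close>.\<close>

lemma vanishing_factor:
  assumes "finite I" "p \<in> polys_over S" "inj_on \<zeta> I"
    and "\<And>t. t \<in> I \<Longrightarrow> \<zeta> t \<in> S" "\<And>t. t \<in> I \<Longrightarrow> poly p (\<zeta> t) = 0"
  shows "\<exists>q\<in>polys_over S. p = (\<Prod>t\<in>I. [:- \<zeta> t, 1:]) * q"
  using assms
proof (induction I arbitrary: p rule: finite_induct)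
  case (insert s I)
  obtain q where q: "q \<in> polys_over S" "p = [:- \<zeta> s, 1:] * q + [:poly p (\<zeta> s):]"
    using insert.prems by (metis insertI1 poly_remainder_closed)
  then have p: "p = [:- \<zeta> s, 1:] * q" using insert.prems by simp
  have "poly q (\<zeta> t) = 0" if "t \<in> I" for t
  proof -
    have "\<zeta> t \<noteq> \<zeta> s"
      using that insert.hyps insert.prems(2) by (auto simp: inj_on_def)
    then show ?thesis
      using insert.prems(4)[of t] that unfolding p by simp
  qed
  then obtain q' where "q' \<in> polys_over S" "q = (\<Prod>t\<in>I. [:- \<zeta> t, 1:]) * q'"
    using insert.IH[of q] q insert.prems by (auto simp: inj_on_def)
  then show ?case
    using insert.hyps p by (intro bexI[of _ q']) (simp_all add: mult.assoc del: mult_pCons_left)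
qed auto

text \<open>\<open>L\<close> is the Lagrange interpolant of \<open>p\<close> at the nodes:
  \<open>p - L\<close> vanishes at all of them and is divisible by the full product over
  \<open>S\<close>, while \<open>L\<close> divided by that product is the sum of simple fractions.
  The inverses of node differences serve to put the coefficients of \<open>L\<close> in
  \<open>S\<close>.\<close>

lemma partial_fractions:
  assumes "finite I" "p \<in> polys_over S" "inj_on \<zeta> I" "\<And>t. t \<in> I \<Longrightarrow> \<zeta> t \<in> S"
    and inv: "\<And>s t. s \<in> I \<Longrightarrow> t \<in> I \<Longrightarrow> s \<noteq> t \<Longrightarrow> inverse (\<zeta> t - \<zeta> s) \<in> S"
    and z: "\<And>t. t \<in> I \<Longrightarrow> z \<noteq> \<zeta> t"
  shows "\<exists>q\<in>polys_over S. poly p z / (\<Prod>t\<in>I. z - \<zeta> t) = poly q z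
    + (\<Sum>t\<in>I. poly p (\<zeta> t) / (\<Prod>s\<in>I - {t}. \<zeta> t - \<zeta> s) / (z - \<zeta> t))"
proof -
  define B where "B t = poly p (\<zeta> t) / (\<Prod>s\<in>I - {t}. \<zeta> t - \<zeta> s)" for t
  define L where "L = (\<Sum>t\<in>I. smult (B t) (\<Prod>s\<in>I - {t}. [:- \<zeta> s, 1:]))"
  have "B t \<in> S" if "t \<in> I" for t
    unfolding B_def using that assms
    by (auto intro!: divide_closed poly_closed inverse_prod_closed)
  then have "L \<in> polys_over S"
    unfolding L_def using assms
    by (auto intro!: polys_over_sum polys_over_smult polys_over_prod polys_over_linear)
  moreover have "poly L (\<zeta> t) = poly p (\<zeta> t)" if t: "t \<in> I" for t
  proof -
    have nz: "(\<Prod>s\<in>I - {t}. \<zeta> t - \<zeta> s) \<noteq> 0"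
      using assms t by (auto simp: inj_on_def)
    have "poly L (\<zeta> t) = (\<Sum>u\<in>I. if u = t then poly p (\<zeta> t) else 0)"
      unfolding L_def poly_sum poly_smult poly_prod
    proof (intro sum.cong refl)
      fix u assume u: "u \<in> I"
      show "B u * (\<Prod>s\<in>I - {u}. poly [:- \<zeta> s, 1:] (\<zeta> t)) = (if u = t then poly p (\<zeta> t) else 0)"
        using nz t u assms(1) by (auto simp: B_def)
    qed
    then show ?thesis using t assms(1) by simp
  qed
  ultimately obtain q where q: "q \<in> polys_over S" "p - L = (\<Prod>t\<in>I. [:- \<zeta> t, 1:]) * q"
    using vanishing_factor[of I "p - L" \<zeta>] polys_over_diff assms by auto
  then have "p = (\<Prod>t\<in>I. [:- \<zeta> t, 1:]) * q + L"
    by (simp add: algebra_simps)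
  then have "poly p z = (\<Prod>t\<in>I. z - \<zeta> t) * poly q z + poly L z"
    by (simp add: poly_prod)
  moreover have "(\<Prod>t\<in>I. z - \<zeta> t) \<noteq> 0"
    using assms by simp
  moreover have "poly L z / (\<Prod>t\<in>I. z - \<zeta> t) = (\<Sum>t\<in>I. B t / (z - \<zeta> t))"
    unfolding L_def poly_sum poly_smult poly_prod sum_divide_distrib
  proof (intro sum.cong refl)
    fix t assume t: "t \<in> I"
    have "(\<Prod>s\<in>I. z - \<zeta> s) = (z - \<zeta> t) * (\<Prod>s\<in>I - {t}. z - \<zeta> s)"
      using t assms(1) by (simp add: prod.remove)
    moreover have "(\<Prod>s\<in>I - {t}. z - \<zeta> s) \<noteq> 0" using assms by simp
    ultimately show "B t * (\<Prod>s\<in>I - {t}. poly [:- \<zeta> s, 1:] z) / (\<Prod>s\<in>I. z - \<zeta> s) = B t / (z - \<zeta> t)"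
      by simp
  qed
  ultimately show ?thesis
    using q(1) by (intro bexI[of _ q]) (simp_all add: add_divide_distrib B_def)
qed

text \<open>Here no inverse of \<open>\<zeta> t - \<eta>\<close> in \<open>S\<close> is required: the numerator contains
  \<open>Q(\<eta>)\<close> and \<open>(Q(x) - Q(\<eta>)) / (x - \<eta>)\<close> is a polynomial over \<open>S\<close>.\<close>

lemma partial_fractions_extra_pole:
  assumes "finite I" "p \<in> polys_over S" "inj_on \<zeta> I" "\<And>t. t \<in> I \<Longrightarrow> \<zeta> t \<in> S"
    and inv: "\<And>s t. s \<in> I \<Longrightarrow> t \<in> I \<Longrightarrow> s \<noteq> t \<Longrightarrow> inverse (\<zeta> t - \<zeta> s) \<in> S"
    and z: "\<And>t. t \<in> I \<Longrightarrow> z \<noteq> \<zeta> t"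
    and \<eta>: "\<eta> \<in> S" "\<And>t. t \<in> I \<Longrightarrow> \<eta> \<noteq> \<zeta> t" "z \<noteq> \<eta>"
  shows "\<exists>q\<in>polys_over S.
    poly p z * (\<Prod>t\<in>I. \<eta> - \<zeta> t) / (z - \<eta>) / (\<Prod>t\<in>I. z - \<zeta> t) = poly q z
    + (\<Sum>t\<in>I. poly p (\<zeta> t) * (\<Prod>t\<in>I. \<eta> - \<zeta> t) / (\<zeta> t - \<eta>)
        / (\<Prod>s\<in>I - {t}. \<zeta> t - \<zeta> s) / (z - \<zeta> t))
    + poly p \<eta> / (z - \<eta>)"
proof -
  define Q where "Q = (\<Prod>t\<in>I. [:- \<zeta> t, 1:])"
  have poly_Q: "poly Q x = (\<Prod>t\<in>I. x - \<zeta> t)" for x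
    by (simp add: Q_def poly_prod)
  have "Q \<in> polys_over S"
    unfolding Q_def using assms by (auto intro!: polys_over_prod polys_over_linear)
  then obtain M where M: "M \<in> polys_over S" "Q = [:- \<eta>, 1:] * M + [:poly Q \<eta>:]"
    using \<eta> by (metis poly_remainder_closed)
  have QM: "poly Q x = (x - \<eta>) * poly M x + poly Q \<eta>" for x
    by (subst M(2)) (simp add: algebra_simps)
  obtain q1 where q1: "q1 \<in> polys_over S" "p = [:- \<eta>, 1:] * q1 + [:poly p \<eta>:]"
    using \<eta> assms by (metis poly_remainder_closed)
  have pq1: "poly p x = (x - \<eta>) * poly q1 x + poly p \<eta>" for x
    by (subst q1(2)) (simp add: algebra_simps)
  obtain q2 where q2: "q2 \<in> polys_over S"
    "poly (p * M) z / (\<Prod>t\<in>I. z - \<zeta> t) = poly q2 z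
      + (\<Sum>t\<in>I. poly (p * M) (\<zeta> t) / (\<Prod>s\<in>I - {t}. \<zeta> t - \<zeta> s) / (z - \<zeta> t))"
    using partial_fractions[of I "p * M" \<zeta> z] assms M polys_over_mult by blast
  have Qz: "poly Q z \<noteq> 0"
    using z assms(1) by (simp add: poly_Q)
  \<comment> \<open>\<open>M\<close> is the divided difference of \<open>Q\<close> at
    \<open>\<eta>\<close>. Since \<open>Q\<close> vanishes at \<open>\<zeta> t\<close>, the
    cross-level quotient on the right is the value of a polynomial over \<open>S\<close>.\<close>
  have eq: "poly M (\<zeta> t) = - (poly Q \<eta> / (\<zeta> t - \<eta>))" if "t \<in> I" for t
  proof -
    have "poly Q (\<zeta> t) = 0" using that assms(1) by (auto simp: poly_Q)
    then show ?thesis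
      using QM[of "\<zeta> t"] \<eta>(2)[OF that] by (simp add: field_simps add_eq_0_iff)
  qed
  have s: "(\<Sum>t\<in>I. poly (p * M) (\<zeta> t) / (\<Prod>s\<in>I - {t}. \<zeta> t - \<zeta> s) / (z - \<zeta> t))
    = - (\<Sum>t\<in>I. poly p (\<zeta> t) * poly Q \<eta> / (\<zeta> t - \<eta>)
        / (\<Prod>s\<in>I - {t}. \<zeta> t - \<zeta> s) / (z - \<zeta> t))"
    unfolding sum_negf[symmetric] by (intro sum.cong refl) (simp add: eq)
  \<comment> \<open>Replacing Q(\<eta>) by Q(z) - (z - \<eta>) M(z) separates the pole at
    \<open>\<eta>\<close> from those at the nodes; after multiplication by p(z) the first term needs
    one division with remainder and the second is covered by
    \<open>partial_fractions\<close>.\<close>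
  have "poly Q \<eta> / (z - \<eta>) / poly Q z = 1 / (z - \<eta>) - poly M z / poly Q z"
  proof -
    have "poly Q \<eta> = poly Q z - (z - \<eta>) * poly M z" using QM[of z] by simp
    then show ?thesis using Qz \<eta>(3) by (simp add: field_simps)
  qed
  then have "poly p z * (poly Q \<eta> / (z - \<eta>) / poly Q z)
      = poly p z / (z - \<eta>) - poly (p * M) z / poly Q z"
    by (simp only: right_diff_distrib poly_mult times_divide_eq_right mult_1_right)
  also have "poly p z / (z - \<eta>) = poly q1 z + poly p \<eta> / (z - \<eta>)"
    using \<eta>(3) by (subst pq1) (simp add: add_divide_distrib)
  finally have "poly p z * (poly Q \<eta> / (z - \<eta>) / poly Q z) = poly (q1 - q2) z
    + (\<Sum>t\<in>I. poly p (\<zeta> t) * poly Q \<eta> / (\<zeta> t - \<eta>)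
        / (\<Prod>s\<in>I - {t}. \<zeta> t - \<zeta> s) / (z - \<zeta> t)) + poly p \<eta> / (z - \<eta>)"
    using q2(2) s by (simp add: poly_Q)
  then show ?thesis
    using q1(1) q2(1) unfolding poly_Q times_divide_eq_right
    by (intro bexI[of _ "q1 - q2"] polys_over_diff)
qed

end

section \<open>The coefficient rings and normal-ordered products\<close>

interpretation Rset: field_subring "Rset n a" for n a
proof
  show "0 \<in> Rset n a" "1 \<in> Rset n a"
    using R_const[of 0 n a] R_const[of 1 n a] by simp_all
  show "- x \<in> Rset n a" if "x \<in> Rset n a" for x
    using R_mult[OF R_const[of "- 1"] that] by (simp add: constK_uminus)
qed (auto intro: R_add R_mult)

lemma Rset_vK_powi: "vK powi k \<in> Rset n a"
  by (intro Rset.power_int_closed R_v R_vinv)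

text \<open>The denominators in \<open>R_loc\<close> are inverted for all integers \<open>m\<close>:
  the automorphism turns one of them into another, with a different \<open>m\<close>, times a power
  of v.\<close>

lemma sigmaK_Rset: "x \<in> Rset n a \<Longrightarrow> sigmaK d x \<in> Rset n a"
proof (induction rule: Rset.induct)
  case (R_loc i r s m)
  let ?p = "2 * Poly_Mapping.lookup d (i, r)" and ?q = "2 * Poly_Mapping.lookup d (i, s)"
  have "sigmaK d (wK i r - vK powi m * wK i s)
      = vK powi ?p * (wK i r - vK powi (m + ?q - ?p) * wK i s)"
    unfolding sigmaK_diff sigmaK_mult sigmaK_power_int sigmaK_vK sigmaK_wK
    by (simp add: algebra_simps power_int_add power_int_diff)
  then have "sigmaK d (inverse (wK i r - vK powi m * wK i s))
      = vK powi (- ?p) * inverse (wK i r - vK powi (m + ?q - ?p) * wK i s)"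
    by (simp add: sigmaK_inverse power_int_minus)
  then show ?case
    using R_loc by (auto intro!: R_mult Rset_vK_powi Rset.R_loc simp del: sigmaK_inverse)
qed (auto simp: sigmaK_hom sigmaK_varK power_int_minus[symmetric]
    intro: Rset.intros intro!: R_mult Rset_vK_powi)

lemma poly_zK_Rzset: "p \<in> polys_over (Rset n a) \<Longrightarrow> poly p zK \<in> Rzset n a"
proof (induction p)
  case 0
  then show ?case using Rset.zero_closed Rz_R by simp
next
  case (pCons c p)
  then have "c \<in> Rset n a" "p \<in> polys_over (Rset n a)"
    by (simp_all add: pCons_polys_over_iff)
  with pCons show ?case by (auto intro: Rz_add Rz_mult Rz_z Rz_R)
qed

lemma qmul_superset:
  assumes "finite A" "Poly_Mapping.keys a \<subseteq> A" "finite B" "Poly_Mapping.keys b \<subseteq> B"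
  shows "qmul a b = (\<Sum>j\<in>A. \<Sum>l\<in>B.
       Poly_Mapping.single (j + l) (Poly_Mapping.lookup a j * sigmaK j (Poly_Mapping.lookup b l)))"
proof -
  have "(\<Sum>l\<in>Poly_Mapping.keys b. Poly_Mapping.single (j + l) (c * sigmaK j (Poly_Mapping.lookup b l)))
      = (\<Sum>l\<in>B. Poly_Mapping.single (j + l) (c * sigmaK j (Poly_Mapping.lookup b l)))" for j c
    using sum_keys_superset[OF assms(3,4), of "\<lambda>l y. Poly_Mapping.single (j + l) (c * sigmaK j y)"]
    by simp
  then show ?thesis
    unfolding qmul_def
    using sum_keys_superset[OF assms(1,2), of "\<lambda>j x. \<Sum>l\<in>B.
       Poly_Mapping.single (j + l) (x * sigmaK j (Poly_Mapping.lookup b l))"]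
    by simp
qed

lemma qmul_0 [simp]: "qmul 0 b = 0" "qmul a 0 = 0"
  by (simp_all add: qmul_def)

lemma qmul_add_left: "qmul (a + a') b = qmul a b + qmul a' b"
proof -
  let ?A = "Poly_Mapping.keys a \<union> Poly_Mapping.keys a'"
  show ?thesis
    using keys_add[of a a']
    by (simp add: qmul_superset[of ?A _ "Poly_Mapping.keys b"] lookup_add distrib_right
        single_add sum.distrib)
qed

lemma qmul_add_right: "qmul a (b + b') = qmul a b + qmul a b'"
proof -
  let ?B = "Poly_Mapping.keys b \<union> Poly_Mapping.keys b'"
  show ?thesis
    using keys_add[of b b']
    by (simp add: qmul_superset[of "Poly_Mapping.keys a" _ ?B] lookup_add distrib_left
        sigmaK_add single_add sum.distrib)
qed

lemma qmul_sum_left: "qmul (sum f A) b = (\<Sum>x\<in>A. qmul (f x) b)"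
  by (induction A rule: infinite_finite_induct) (auto simp: qmul_add_left)

lemma qmul_sum_right: "qmul a (sum f A) = (\<Sum>x\<in>A. qmul a (f x))"
  by (induction A rule: infinite_finite_induct) (auto simp: qmul_add_right)

lemma qmul_single:
  "qmul (Poly_Mapping.single j x) (Poly_Mapping.single l y) = Poly_Mapping.single (j + l) (x * sigmaK j y)"
  by (subst qmul_superset[of "{j}" _ "{l}"]) auto

lemma in_Atz_0: "in_Atz n a 0"
  by (simp add: in_Atz_def)

lemma in_Atz_add:
  assumes "in_Atz n a p" "in_Atz n a q"
  shows "in_Atz n a (p + q)"
  unfolding in_Atz_def
proof
  fix d assume d: "d \<in> Poly_Mapping.keys (p + q)"
  have z: "0 \<in> Rzset n a" using Rset.zero_closed Rz_R by blast
  \<comment> \<open>A monomial occurring in one summand may be absent from the other; its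
    coefficient there is 0, which also lies in \<open>Rzset n a\<close>.\<close>
  have *: "Poly_Mapping.lookup f d \<in> Rzset n a" if "in_Atz n a f" for f
    using that z by (cases "d \<in> Poly_Mapping.keys f") (auto simp: in_Atz_def in_keys_iff)
  have "d \<in> Poly_Mapping.keys p \<union> Poly_Mapping.keys q"
    using subsetD[OF keys_add d] .
  then show "Poly_Mapping.keys d \<subseteq> {(i, r). 1 \<le> i \<and> i < n \<and> 1 \<le> r \<and> r \<le> a i}
      \<and> Poly_Mapping.lookup (p + q) d \<in> Rzset n a"
    using assms *[OF assms(1)] *[OF assms(2)] by (auto simp: in_Atz_def lookup_add intro: Rz_add)
qed

lemma in_Atz_sum: "(\<And>x. x \<in> A \<Longrightarrow> in_Atz n a (f x)) \<Longrightarrow> in_Atz n a (sum f A)"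
  by (induction A rule: infinite_finite_induct) (auto intro: in_Atz_add in_Atz_0)

lemma in_Atz_single:
  assumes "Poly_Mapping.keys d \<subseteq> {(i, r). 1 \<le> i \<and> i < n \<and> 1 \<le> r \<and> r \<le> a i}" "c \<in> Rzset n a"
  shows "in_Atz n a (Poly_Mapping.single d c)"
  using assms by (simp add: in_Atz_def)

section \<open>Coefficients of the triangular factors\<close>

lemma prod_diff_factor:
  fixes y :: "'a::field"
  assumes "y \<noteq> 0"
  shows "(\<Prod>s\<in>I. y - c s) = y ^ card I * (\<Prod>s\<in>I. 1 - c s / y)"
  using assms by (simp add: right_diff_distrib flip: prod_constant prod.distrib)

text \<open>The common shape of all w-dependent roots and poles in z; the automorphisms change only
  the power of v.\<close>

definition vw :: "int \<Rightarrow> nat \<Rightarrow> nat \<Rightarrow> K" where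
  "vw k i r = vK powi k * wK i r"

lemma vw_nonzero [simp]: "vw k i r \<noteq> 0"
  by (simp add: vw_def)

lemma vw_monK: "vw k i r = monK (Poly_Mapping.single Vv k + Poly_Mapping.single (Uv i r) 2)"
  by (simp add: vw_def monK_add monK_single_powi)

text \<open>The variable \<open>Uv i r\<close> has exponent 2 on the left and must therefore occur
  on the right. Points belonging to different pairs are thus different whatever their powers of
  v.\<close>

lemma vw_eqD:
  assumes "vw k i r = vw l j s"
  shows "i = j \<and> r = s"
proof -
  have "Poly_Mapping.single Vv k + Poly_Mapping.single (Uv i r) 2
      = Poly_Mapping.single Vv l + Poly_Mapping.single (Uv j s) 2"
    using assms by (simp add: vw_monK monK_eq_iff)
  then have "Poly_Mapping.lookup (Poly_Mapping.single Vv k + Poly_Mapping.single (Uv i r) 2) (Uv i r)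
      = Poly_Mapping.lookup (Poly_Mapping.single Vv l + Poly_Mapping.single (Uv j s) (2::int)) (Uv i r)"
    by simp
  then show ?thesis
    by (auto simp: lookup_add lookup_single when_def split: if_splits)
qed

lemma constK_neq_monK:
  assumes "m \<noteq> 0"
  shows "constK c \<noteq> monK m"
proof
  assume "constK c = monK m"
  then have "Poly_Mapping.keys (Poly_Mapping.single (0 :: tvar \<Rightarrow>\<^sub>0 int) c)
      = Poly_Mapping.keys (Poly_Mapping.single m (1 :: complex))"
    by (simp only: constK_eq_LPK monK_def LPK_eq_iff)
  then show False using assms by (auto split: if_splits)
qed

text \<open>Guarantees that the value of Z_j at a pole is nonzero, so that it can be divided out
  when residues are compared.\<close>

lemma vw_neq_constK: "vw k i r \<noteq> constK c"
proof -
  have "Poly_Mapping.lookup (Poly_Mapping.single Vv k + Poly_Mapping.single (Uv i r) (2::int)) (Uv i r)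
      \<noteq> Poly_Mapping.lookup 0 (Uv i r)"
    by (simp add: lookup_add lookup_single)
  then have "Poly_Mapping.single Vv k + Poly_Mapping.single (Uv i r) (2::int) \<noteq> 0"
    by force
  then show ?thesis
    using constK_neq_monK unfolding vw_monK by metis
qed

lemma zK_neq_constK: "zK \<noteq> constK c"
  using constK_neq_monK[of "Poly_Mapping.single Zv 1" c] unfolding varK_eq_monK
  by (metis lookup_single_eq lookup_zero zero_neq_one)

lemma zK_neq_vw: "zK \<noteq> vw k i r"
proof
  assume "zK = vw k i r"
  then have "Poly_Mapping.single Zv 1
      = Poly_Mapping.single Vv k + Poly_Mapping.single (Uv i r) 2"
    by (simp only: varK_eq_monK vw_monK monK_eq_iff)
  then have "Poly_Mapping.lookup (Poly_Mapping.single Zv 1) Zv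
      = Poly_Mapping.lookup (Poly_Mapping.single Vv k + Poly_Mapping.single (Uv i r) (2::int)) Zv"
    by (rule arg_cong)
  then show False by (simp add: lookup_add lookup_single)
qed

lemma sigmaK_vw: "sigmaK d (vw k i r) = vw (k + 2 * Poly_Mapping.lookup d (i, r)) i r"
  unfolding vw_def sigmaK_mult sigmaK_power_int sigmaK_wK by (simp add: power_int_add)

lemma wK_eq_vw: "wK i r = vw 0 i r"
  by (simp add: vw_def)

lemma vK_mult_vw: "vK * vw k i r = vw (k + 1) i r" "inverse vK * vw k i r = vw (k - 1) i r"
  "vK ^ m * vw k i r = vw (k + int m) i r" "vK powi l * vw k i r = vw (k + l) i r"
  by (simp_all add: vw_def power_int_add power_int_diff field_simps)

section \<open>D-exponents and the lower triangular factor\<close>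

lemma lookup_Dexp:
  "Poly_Mapping.lookup (Dexp i j r) (k, s) = (if i \<le> k \<and> k < j \<and> r k = s then 1 else 0)"
proof -
  have "Poly_Mapping.lookup (Dexp i j r) (k, s) = (\<Sum>l\<in>{i..<j}. if l = k then (if r k = s then 1 else 0) else 0)"
    unfolding Dexp_def lookup_sum lookup_single by (intro sum.cong refl) (auto simp: when_def)
  then show ?thesis by (simp add: sum.delta)
qed

lemma Dexp_refl [simp]: "Dexp i i r = 0"
  by (simp add: Dexp_def)

text \<open>Prepending an entry \<open>t\<close> at index \<open>j\<close> to a tuple that starts at
  j + 1: this is how the tuples of two consecutive values of i are related.\<close>

lemma Dexp_step: "j < l \<Longrightarrow> Dexp j l (r(j := t)) = Dexp (Suc j) l r + Poly_Mapping.single (j, t) 1"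
  by (simp add: Dexp_def sum.atLeast_Suc_lessThan add.commute)

definition uprod :: "(nat \<Rightarrow> nat) \<Rightarrow> nat \<Rightarrow> K" where
  "uprod a k = (\<Prod>t=1..a k. uK k t)"

lemma uprod_nonzero [simp]: "uprod a k \<noteq> 0"
  by (simp add: uprod_def)

lemma sigmaK_uprod:
  "sigmaK d (uprod a k) = vK powi (\<Sum>t=1..a k. Poly_Mapping.lookup d (k, t)) * uprod a k"
proof -
  have "(\<Prod>t\<in>I. vK powi f t) = vK powi (sum f I)" for f :: "nat \<Rightarrow> int" and I
    by (induction I rule: infinite_finite_induct) (auto simp: power_int_add)
  then show ?thesis
    by (simp add: uprod_def sigmaK_prod sigmaK_varK prod.distrib)
qed

text \<open>A coefficient of \<open>f\<close>, stripped of its factor \<open>1 / (z - v\<^sup>i\<^sup>+\<^sup>2 w)\<close>.\<close>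

definition lowc :: "(nat \<Rightarrow> nat) \<Rightarrow> nat \<Rightarrow> nat \<Rightarrow> (nat \<Rightarrow> nat) \<Rightarrow> K" where
  "lowc a \<alpha> i r = (if i < \<alpha> then
     (- 1) ^ (\<alpha> - i) * vK powi (2 * int i + 2 - int \<alpha>) * wK (\<alpha> - 1) (r (\<alpha> - 1))
     * inverse (\<Prod>k=i+1..\<alpha>. uprod a k)
     * WW a \<alpha> (vK * wK (\<alpha> - 1) (r (\<alpha> - 1)))
     * (\<Prod>k=i+1..<\<alpha>. WWr a k (r k) (vK * wK (k - 1) (r (k - 1))))
     / (\<Prod>k=i..<\<alpha>. WWr a k (r k) (wK k (r k)))
     else 1)"

lemma WWr_nonzero:
  assumes "\<And>s. s \<in> {1..a k} - {r} \<Longrightarrow> (k, s) \<noteq> (i, t)"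
  shows "WWr a k r (vw m i t) \<noteq> 0"
proof -
  have "1 - wK k s / vw m i t \<noteq> 0" if "s \<in> {1..a k} - {r}" for s
    using assms[OF that] vw_eqD[of 0 k s m i t] by (auto simp: wK_eq_vw)
  then show ?thesis by (simp add: WWr_def)
qed

lemma vw_divide_vw: "vw m k s / vw l i t = wK k s / vw (l - m) i t"
  by (simp add: vw_def power_int_diff)

lemma WW_prod: "(\<Prod>s=1..a k. vw l i t - vw m k s) = vw l i t ^ a k * WW a k (vw (l - m) i t)"
  by (simp only: prod_diff_factor[OF vw_nonzero] WW_def vw_divide_vw card_atLeastAtMost diff_Suc_1)

lemma WWr_prod:
  assumes "r \<in> {1..a k}"
  shows "(\<Prod>s\<in>{1..a k} - {r}. vw l i t - vw m k s)
    = vw l i t powi (int (a k) - 1) * WWr a k r (vw (l - m) i t)"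
proof -
  have "vw l i t ^ card ({1..a k} - {r}) = vw l i t powi (int (a k) - 1)"
    using assms by (simp add: of_nat_diff flip: power_int_of_nat)
  then show ?thesis by (simp only: prod_diff_factor[OF vw_nonzero] WWr_def vw_divide_vw)
qed

text \<open>Only the factors at index \<open>j\<close> and the one linking w_{j,t} to level j + 1
  are new; v^(-2) is the change of the prefactor v^(2i+2-\<alpha>) when i drops by 1.\<close>

lemma lowc_step:
  assumes "Suc j < \<alpha>"
  shows "lowc a \<alpha> j (r(j := t)) = - (vK powi (- 2)) * inverse (uprod a (Suc j))
    * WWr a (Suc j) (r (Suc j)) (vK * wK j t) / WWr a j t (wK j t) * lowc a \<alpha> (Suc j) r"
proof -
  let ?r = "r(j := t)"
  have "(- 1 :: K) ^ (\<alpha> - j) = - ((- 1) ^ (\<alpha> - Suc j))"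
    using assms by (metis Suc_diff_Suc Suc_lessD mult_minus1 power_Suc)
  moreover have "vK powi (2 * int j + 2 - int \<alpha>) = vK powi (- 2) * vK powi (2 * int (Suc j) + 2 - int \<alpha>)"
    by (simp add: algebra_simps flip: power_int_add)
  moreover have "(\<Prod>k=j+1..\<alpha>. uprod a k) = uprod a (Suc j) * (\<Prod>k=Suc j+1..\<alpha>. uprod a k)"
    using assms by (simp add: prod.atLeast_Suc_atMost)
  moreover have "(\<Prod>k=j+1..<\<alpha>. WWr a k (?r k) (vK * wK (k - 1) (?r (k - 1))))
     = WWr a (Suc j) (r (Suc j)) (vK * wK j t)
       * (\<Prod>k=Suc j+1..<\<alpha>. WWr a k (r k) (vK * wK (k - 1) (r (k - 1))))"
  proof -
    have "(\<Prod>k=j+1..<\<alpha>. WWr a k (?r k) (vK * wK (k - 1) (?r (k - 1))))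
     = WWr a (Suc j) (r (Suc j)) (vK * wK j t)
       * (\<Prod>k=Suc j+1..<\<alpha>. WWr a k (?r k) (vK * wK (k - 1) (?r (k - 1))))"
      using assms by (simp add: prod.atLeast_Suc_lessThan)
    also have "(\<Prod>k=Suc j+1..<\<alpha>. WWr a k (?r k) (vK * wK (k - 1) (?r (k - 1))))
      = (\<Prod>k=Suc j+1..<\<alpha>. WWr a k (r k) (vK * wK (k - 1) (r (k - 1))))"
      by (intro prod.cong) auto
    finally show ?thesis .
  qed
  moreover have "(\<Prod>k=j..<\<alpha>. WWr a k (?r k) (wK k (?r k)))
      = WWr a j t (wK j t) * (\<Prod>k=Suc j..<\<alpha>. WWr a k (r k) (wK k (r k)))"
    using assms by (simp add: prod.atLeast_Suc_lessThan)
  moreover have "?r (\<alpha> - 1) = r (\<alpha> - 1)" using assms by auto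
  ultimately show ?thesis
    using assms unfolding lowc_def by (simp add: mult_ac)
qed

text \<open>The contribution of f and of the numerator of g to the residue at
  \<open>\<zeta>\<close>. Dropping the root that cancels the pole of f leaves the product over s
  \<noteq> r_{j+1}, which is the new numerator factor of \<open>lowc_step\<close>. If \<alpha> = j +
  1, nothing is dropped and the full product gives the factor W_\<alpha> of
  \<open>lowc\<close>.\<close>

lemma lower_residue:
  assumes "Suc j \<le> \<alpha>" "t \<in> {1..a j}" "Suc j < \<alpha> \<Longrightarrow> r (Suc j) \<in> {1..a (Suc j)}"
    and d: "d = Dexp (Suc j) \<alpha> r" and \<zeta>: "\<zeta> = vw (int j + 2) j t"
    and \<eta>: "\<And>s. \<eta> s = sigmaK d (vw (int (Suc j)) (Suc j) s)"
  shows "lowc a \<alpha> (Suc j) r * inverse (sigmaK d (uprod a (Suc j)))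
     * ((\<Prod>s=1..a (Suc j). \<zeta> - \<eta> s) * (if Suc j < \<alpha> then 1 / (\<zeta> - \<eta> (r (Suc j))) else 1))
   = - vK * \<zeta> powi (int (a (Suc j)) - 1) * lowc a \<alpha> j (r(j := t)) * WWr a j t (wK j t)"
proof (cases "Suc j < \<alpha>")
  case True
  have ri: "r (Suc j) \<in> {1..a (Suc j)}" using assms True by simp
  have "sigmaK d (uprod a (Suc j)) = vK * uprod a (Suc j)"
    using True ri by (simp add: sigmaK_uprod d lookup_Dexp)
  moreover have "\<zeta> \<noteq> \<eta> (r (Suc j))"
    by (auto simp: \<zeta> \<eta> sigmaK_vw dest: vw_eqD)
  moreover have "(\<Prod>s=1..a (Suc j). \<zeta> - \<eta> s)
      = (\<zeta> - \<eta> (r (Suc j))) * (\<Prod>s\<in>{1..a (Suc j)} - {r (Suc j)}. \<zeta> - \<eta> s)"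
    using ri by (simp add: prod.remove)
  moreover have "(\<Prod>s\<in>{1..a (Suc j)} - {r (Suc j)}. \<zeta> - \<eta> s)
      = (\<Prod>s\<in>{1..a (Suc j)} - {r (Suc j)}. vw (int j + 2) j t - vw (int (Suc j)) (Suc j) s)"
    by (intro prod.cong) (auto simp: \<zeta> \<eta> sigmaK_vw d lookup_Dexp)
  moreover have "\<dots> = \<zeta> powi (int (a (Suc j)) - 1) * WWr a (Suc j) (r (Suc j)) (vw 1 j t)"
    using WWr_prod[of "r (Suc j)" a "Suc j" "int j + 2" j t "int (Suc j)"] ri by (simp add: \<zeta>)
  moreover have "WWr a j t (wK j t) \<noteq> 0"
    unfolding wK_eq_vw by (rule WWr_nonzero) auto
  moreover have "vw 1 j t = vK * wK j t" by (simp add: vw_def)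
  moreover have "vK powi (- 2) = inverse vK * inverse vK"
    by (simp add: power_int_minus power2_eq_square)
  ultimately have "(\<Prod>s=1..a (Suc j). \<zeta> - \<eta> s) / (\<zeta> - \<eta> (r (Suc j)))
      = \<zeta> powi (int (a (Suc j)) - 1) * WWr a (Suc j) (r (Suc j)) (vK * wK j t)"
      "WWr a j t (wK j t) \<noteq> 0" "vK powi (- 2) = inverse vK * inverse vK"
      "sigmaK d (uprod a (Suc j)) = vK * uprod a (Suc j)"
    by simp_all
  then show ?thesis
    using True by (simp add: lowc_step)
next
  case False
  with assms have \<alpha>: "\<alpha> = Suc j" by simp
  have "\<eta> = vw (int (Suc j)) (Suc j)"
    by (rule ext) (simp add: \<eta> d \<alpha>)
  moreover have "(\<Prod>s=1..a (Suc j). \<zeta> - vw (int (Suc j)) (Suc j) s)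
    = \<zeta> ^ a (Suc j) * WW a (Suc j) (vw 1 j t)"
    using WW_prod[of "int j + 2" j t "int (Suc j)" "Suc j" a] by (simp add: \<zeta>)
  moreover have "WWr a j t (wK j t) \<noteq> 0"
    unfolding wK_eq_vw by (rule WWr_nonzero) auto
  \<comment> \<open>Without a dropped root there is one more factor \<open>\<zeta>\<close>; it
    accounts for the prefactor v^(2j+2-\<alpha>) w_{j,t} in \<open>lowc a \<alpha> j\<close>, up to
    a single v.\<close>
  moreover have "\<zeta> ^ a (Suc j) = \<zeta> * \<zeta> powi (int (a (Suc j)) - 1)"
    by (simp add: \<zeta> power_int_diff)
  moreover have "\<zeta> = vK * vK powi (2 * int j + 2 - int (Suc j)) * wK j t"
    by (simp add: \<zeta> vw_def power_int_add power2_eq_square)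
  ultimately show ?thesis
    by (simp add: \<alpha> d lowc_def wK_eq_vw vK_mult_vw field_simps)
qed

text \<open>Separates one coordinate of the tuples; it is applied to the lowest index, to reach
  tuples starting one index later.\<close>

lemma sum_PiE_insert:
  assumes "x \<notin> A"
  shows "(\<Sum>f\<in>(\<Pi>\<^sub>E k\<in>insert x A. B k). h f) = (\<Sum>t\<in>B x. \<Sum>f\<in>(\<Pi>\<^sub>E k\<in>A. B k). h (f(x := t)))"
proof -
  have "(\<Sum>f\<in>(\<Pi>\<^sub>E k\<in>insert x A. B k). h f)
      = (\<Sum>p\<in>B x \<times> (\<Pi>\<^sub>E k\<in>A. B k). h ((\<lambda>(t, f). f(x := t)) p))"
    unfolding PiE_insert_eq using inj_combinator[OF assms]
    by (rule sum.reindex[unfolded o_def])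
  then show ?thesis by (simp add: sum.cartesian_product case_prod_unfold)
qed

section \<open>The upper triangular factor\<close>

locale trig_lax =
  fixes n N :: nat and "is" :: "nat \<Rightarrow> nat" and xs :: "nat \<Rightarrow> complex"
    and gam mup mum :: "nat \<Rightarrow> int" and a :: "nat \<Rightarrow> nat"
  assumes divisor: "trig_divisor n N is xs gam mup mum"
    and integral: "integrality n N is gam mup mum a"
begin

abbreviation Z :: "nat \<Rightarrow> K \<Rightarrow> K" where "Z \<equiv> ZZ N is xs gam"

text \<open>A coefficient of \<open>e\<close> times \<open>uprod a (i - 1)\<close>, stripped of the factors \<open>W\<close>
  at index \<open>i - 1\<close> and \<open>z / (z - v\<^sup>i w)\<close>.\<close>

definition upc :: "nat \<Rightarrow> nat \<Rightarrow> (nat \<Rightarrow> nat) \<Rightarrow> K" where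
  "upc \<beta> i r = (if i < \<beta> then
     (- 1) powi (int i - int \<beta> + 1) * (\<Prod>t=1..a (\<beta> - 1). wK (\<beta> - 1) t)
     * (\<Prod>k=i..\<beta> - 2. uprod a k)
     * (\<Prod>k=i..<\<beta>. (vK ^ k * wK k (r k)) powi (- alphav k mup))
     * (\<Prod>k=i..\<beta> - 2. WWr a k (r k) (inverse vK * wK (k + 1) (r (k + 1))))
     / (\<Prod>k=i..<\<beta>. WWr a k (r k) (wK k (r k)))
     * (\<Prod>k=i..<\<beta>. Z k (wK k (r k)))
     * wK i (r i) / wK (\<beta> - 1) (r (\<beta> - 1))
     else uprod a (\<beta> - 1))"

text \<open>With \<beta> = j + 1 the ranges \<open>j..\<beta> - 2\<close> are empty;
  \<open>1 \<le> j\<close> is what keeps the truncated subtraction from making them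
  nonempty.\<close>

lemma upc_base:
  assumes "1 \<le> j"
  shows "upc (Suc j) j r = uprod a j ^ 2 * (vK ^ j * wK j (r j)) powi (- alphav j mup)
    / WWr a j (r j) (wK j (r j)) * Z j (wK j (r j))"
  using assms by (simp add: upc_def uprod_def prod_power_distrib)

lemma upc_step:
  assumes "1 \<le> j" "Suc j < \<beta>"
  shows "upc \<beta> j (r(j := t)) = - upc \<beta> (Suc j) r * uprod a j
    * (vK ^ j * wK j t) powi (- alphav j mup)
    * WWr a j t (inverse vK * wK (Suc j) (r (Suc j))) / WWr a j t (wK j t)
    * Z j (wK j t) * wK j t / wK (Suc j) (r (Suc j))"
proof -
  let ?r = "r(j := t)"
  have "(- 1 :: K) powi (int j - int \<beta> + 1) = - ((- 1) powi (int (Suc j) - int \<beta> + 1))"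
    using power_int_add_1[of "-1 :: K" "int j - int \<beta> + 1"] by (simp add: algebra_simps)
  moreover have "(\<Prod>k=j..\<beta> - 2. uprod a k) = uprod a j * (\<Prod>k=Suc j..\<beta> - 2. uprod a k)"
    using assms by (simp add: prod.atLeast_Suc_atMost)
  moreover have "(\<Prod>k=j..<\<beta>. (vK ^ k * wK k (?r k)) powi (- alphav k mup))
     = (vK ^ j * wK j t) powi (- alphav j mup)
       * (\<Prod>k=Suc j..<\<beta>. (vK ^ k * wK k (r k)) powi (- alphav k mup))"
    using assms by (simp add: prod.atLeast_Suc_lessThan)
  moreover have "(\<Prod>k=j..\<beta> - 2. WWr a k (?r k) (inverse vK * wK (k + 1) (?r (k + 1))))
     = WWr a j t (inverse vK * wK (Suc j) (r (Suc j)))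
       * (\<Prod>k=Suc j..\<beta> - 2. WWr a k (r k) (inverse vK * wK (k + 1) (r (k + 1))))"
    using assms by (simp add: prod.atLeast_Suc_atMost)
  moreover have "(\<Prod>k=j..<\<beta>. WWr a k (?r k) (wK k (?r k)))
      = WWr a j t (wK j t) * (\<Prod>k=Suc j..<\<beta>. WWr a k (r k) (wK k (r k)))"
    using assms by (simp add: prod.atLeast_Suc_lessThan)
  moreover have "(\<Prod>k=j..<\<beta>. Z k (wK k (?r k)))
      = Z j (wK j t) * (\<Prod>k=Suc j..<\<beta>. Z k (wK k (r k)))"
    using assms by (simp add: prod.atLeast_Suc_lessThan)
  moreover have "?r (\<beta> - 1) = r (\<beta> - 1)" using assms by auto
  ultimately show ?thesis
    using assms unfolding upc_def by (simp add: mult_ac)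
qed

lemma sigmaK_Z: "sigmaK d (Z k y) = Z k (sigmaK d y)"
  by (simp add: ZZ_def sigmaK_hom)

lemma sigmaK_WWr:
  assumes "\<And>s. s \<in> {1..a k} - {r} \<Longrightarrow> Poly_Mapping.lookup d (k, s) = 0"
  shows "sigmaK d (WWr a k r y) = WWr a k r (sigmaK d y)"
  unfolding WWr_def sigmaK_prod
  by (intro prod.cong refl) (use assms in \<open>simp add: sigmaK_diff sigmaK_divide wK_eq_vw sigmaK_vw\<close>)

text \<open>For i < \<beta> the coefficient involves only variables of level at least i, so the
  automorphism may be changed freely below. In the other branch it is a product at level \<beta> -
  1, whence the separate hypothesis.\<close>

lemma sigmaK_upc_cong:
  assumes "\<And>k s. i \<le> k \<Longrightarrow> Poly_Mapping.lookup d (k, s) = Poly_Mapping.lookup d' (k, s)"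
    and "i \<le> \<beta>" "1 \<le> \<beta>" "i = \<beta> \<Longrightarrow> sigmaK d (uprod a (\<beta> - 1)) = sigmaK d' (uprod a (\<beta> - 1))"
  shows "sigmaK d (upc \<beta> i r) = sigmaK d' (upc \<beta> i r)"
proof (cases "i < \<beta>")
  case True
  have u: "sigmaK d (uprod a k) = sigmaK d' (uprod a k)"
    and w: "sigmaK d (uK k s) = sigmaK d' (uK k s)" if "i \<le> k" for k s
    using assms(1)[OF that] by (simp_all add: sigmaK_uprod sigmaK_varK)
  have W: "sigmaK d (WWr a k s y) = sigmaK d' (WWr a k s y)"
    if "i \<le> k" "sigmaK d y = sigmaK d' y" for k s y
    unfolding WWr_def by (simp add: sigmaK_hom w that)
  show ?thesis
    unfolding upc_def using True
    by (simp add: sigmaK_hom sigmaK_Z u w W cong: prod.cong_simp)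
next
  case False
  then show ?thesis using assms by (simp add: upc_def)
qed

text \<open>The contribution of e to the residue at \<open>\<zeta>\<close>. The additional D_{j,t}
  in \<open>d'\<close> moves v^j w_{j,t} exactly to \<open>\<zeta>\<close>, so the level-j factors
  of e in the summand for j become values at the pole of the summand for j + 1.\<close>

lemma upper_residue:
  assumes "1 \<le> j" "Suc j \<le> \<beta>" "t \<in> {1..a j}"
    and d: "\<And>s. Poly_Mapping.lookup d (j, s) = 0"
    and d': "d' = d + Poly_Mapping.single (j, t) 1" and \<zeta>: "\<zeta> = vw (int j + 2) j t"
    and \<eta>: "\<eta> = sigmaK d (vw (int (Suc j)) (Suc j) (r (Suc j)))"
  shows "sigmaK d' (inverse (uprod a j) * upc \<beta> j (r(j := t)))
    = vK * \<zeta> powi (- alphav j mup) * Z j (vw 2 j t) / WWr a j t (vw 2 j t)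
      * sigmaK d (upc \<beta> (Suc j) r)
      * (if Suc j < \<beta> then (\<Prod>s=1..a j. 1 - vw (int j + 2) j s / \<eta>) * (\<zeta> / (\<zeta> - \<eta>)) else 1)"
proof -
  have lookup: "Poly_Mapping.lookup d' (k, s)
      = Poly_Mapping.lookup d (k, s) + (if k = j \<and> s = t then 1 else 0)" for k s
    by (simp add: d' lookup_add lookup_single when_def)
  have w: "sigmaK d' (wK j t) = vw 2 j t"
    by (simp add: wK_eq_vw sigmaK_vw lookup d)
  have vw: "sigmaK d' ((vK ^ j * wK j t) powi k) = \<zeta> powi k" for k
    by (simp only: sigmaK_power_int) (simp add: wK_eq_vw vK_mult_vw sigmaK_vw lookup d \<zeta> add.commute)
  have W: "sigmaK d' (WWr a j t y) = WWr a j t (sigmaK d' y)" for y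
    by (rule sigmaK_WWr) (auto simp: lookup d)
  have U: "sigmaK d' (uprod a j) = vK * uprod a j"
    using assms(3) by (simp add: sigmaK_uprod lookup d)
  show ?thesis
  proof (cases "Suc j < \<beta>")
    case True
    define l where "l = 2 * Poly_Mapping.lookup d (Suc j, r (Suc j))"
    have \<eta>': "\<eta> = vw (int (Suc j) + l) (Suc j) (r (Suc j))"
      by (simp add: \<eta> sigmaK_vw l_def)
    have w': "sigmaK d' (wK (Suc j) (r (Suc j))) = vw l (Suc j) (r (Suc j))"
      "sigmaK d' (inverse vK * wK (Suc j) (r (Suc j))) = vw (l - 1) (Suc j) (r (Suc j))"
      by (simp_all add: wK_eq_vw vK_mult_vw sigmaK_vw lookup l_def)
    have upc: "sigmaK d' (upc \<beta> (Suc j) r) = sigmaK d (upc \<beta> (Suc j) r)"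
      using True by (intro sigmaK_upc_cong) (auto simp: lookup)
    have ne: "\<zeta> \<noteq> \<eta>" "\<eta> \<noteq> 0"
      by (auto simp: \<zeta> \<eta>' dest: vw_eqD)
    have "(\<Prod>s=1..a j. 1 - vw (int j + 2) j s / \<eta>)
        = (1 - \<zeta> / \<eta>) * WWr a j t (vw (l - 1) (Suc j) (r (Suc j)))"
      using assms(3) by (simp add: prod.remove \<zeta> WWr_def \<eta>' vw_divide_vw)
    then have "(\<Prod>s=1..a j. 1 - vw (int j + 2) j s / \<eta>) * (\<zeta> / (\<zeta> - \<eta>))
        = (1 - \<zeta> / \<eta>) * (\<zeta> / (\<zeta> - \<eta>)) * WWr a j t (vw (l - 1) (Suc j) (r (Suc j)))"
      by (simp only: mult_ac)
    \<comment> \<open>The factor s = t of W_j cancels the denominator of e and leaves a sign and a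
      ratio; the other factors form the \<open>WWr\<close> of \<open>upc_step\<close>.\<close>
    also have "(1 - \<zeta> / \<eta>) * (\<zeta> / (\<zeta> - \<eta>)) = - (\<zeta> / \<eta>)"
      using ne by (simp add: divide_simps) (simp add: algebra_simps)
    finally have "(\<Prod>s=1..a j. 1 - vw (int j + 2) j s / \<eta>) * (\<zeta> / (\<zeta> - \<eta>))
        = - WWr a j t (vw (l - 1) (Suc j) (r (Suc j))) * (\<zeta> / \<eta>)"
      by simp
    moreover have "vK * (\<zeta> / \<eta>) = vw 2 j t / vw l (Suc j) (r (Suc j))"
      by (simp add: \<zeta> \<eta>' vw_def power_int_add power_int_diff field_simps power2_eq_square)
    ultimately have *: "vK * ((\<Prod>s=1..a j. 1 - vw (int j + 2) j s / \<eta>) * (\<zeta> / (\<zeta> - \<eta>)))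
        = - WWr a j t (vw (l - 1) (Suc j) (r (Suc j))) * (vw 2 j t / vw l (Suc j) (r (Suc j)))"
      by (simp only: mult.left_commute[of vK])
    have "inverse (uprod a j) * upc \<beta> j (r(j := t)) = - upc \<beta> (Suc j) r
        * (vK ^ j * wK j t) powi (- alphav j mup)
        * WWr a j t (inverse vK * wK (Suc j) (r (Suc j))) / WWr a j t (wK j t)
        * Z j (wK j t) * wK j t / wK (Suc j) (r (Suc j))"
      using True assms(1) by (simp add: upc_step)
    then have "sigmaK d' (inverse (uprod a j) * upc \<beta> j (r(j := t)))
        = - sigmaK d (upc \<beta> (Suc j) r) * \<zeta> powi (- alphav j mup)
          * WWr a j t (vw (l - 1) (Suc j) (r (Suc j))) / WWr a j t (vw 2 j t)
          * Z j (vw 2 j t) * vw 2 j t / vw l (Suc j) (r (Suc j))"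
      by (simp only: sigmaK_mult[of _ _ "WWr _ _ _ _"] sigmaK_mult[of _ _ "Z _ _"] sigmaK_mult[of _ _ "wK j t"]
          sigmaK_mult[of _ _ "_ powi _"] sigmaK_divide sigmaK_uminus vw w w' W sigmaK_Z upc)
    also have "\<dots> = \<zeta> powi (- alphav j mup) * Z j (vw 2 j t) / WWr a j t (vw 2 j t)
        * sigmaK d (upc \<beta> (Suc j) r)
        * (- WWr a j t (vw (l - 1) (Suc j) (r (Suc j))) * (vw 2 j t / vw l (Suc j) (r (Suc j))))"
      by (simp add: mult_ac)
    finally show ?thesis
      unfolding *[symmetric] using True by (simp add: mult_ac)
  next
    case False
    with assms have \<beta>: "\<beta> = Suc j" by simp
    have "inverse (uprod a j) * upc \<beta> j (r(j := t)) = uprod a j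
        * (vK ^ j * wK j t) powi (- alphav j mup) / WWr a j t (wK j t) * Z j (wK j t)"
      using assms(1) by (simp add: \<beta> upc_base power2_eq_square)
    then have "sigmaK d' (inverse (uprod a j) * upc \<beta> j (r(j := t)))
        = vK * uprod a j * \<zeta> powi (- alphav j mup) / WWr a j t (vw 2 j t) * Z j (vw 2 j t)"
      by (simp only: sigmaK_mult[of _ _ "WWr _ _ _ _"] sigmaK_mult[of _ _ "Z _ _"]
          sigmaK_mult[of _ _ "_ powi _"] sigmaK_divide vw w W sigmaK_Z U)
    \<comment> \<open>Here the \<open>else\<close> branch of \<open>upc\<close> applies. It is this
      product, and not 1, because \<open>inverse (uprod a (i - 1))\<close> is split off uniformly,
      also from the diagonal entry 1 of e.\<close>
    moreover have "sigmaK d (upc \<beta> (Suc j) r) = uprod a j"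
      by (simp add: \<beta> upc_def sigmaK_uprod d)
    ultimately show ?thesis by (simp add: \<beta> mult_ac)
  qed
qed

section \<open>Weights, integrality and the divisor factor\<close>

lemma a_0: "a 0 = 0" and a_n: "a n = 0"
  using integral by (simp_all add: integrality_def)

lemma lam_eq: "lam N is gam i = - (\<Sum>s | s \<in> {1..N} \<and> is s < i. gam s)"
proof -
  have "lam N is gam i = (\<Sum>s=1..N. if is s < i then - gam s else 0)"
    unfolding lam_def varpi_def by (intro sum.cong) auto
  also have "\<dots> = (\<Sum>s | s \<in> {1..N} \<and> is s < i. - gam s)"
    by (rule sum.inter_filter[symmetric]) simp
  finally show ?thesis by (simp add: sum_negf)
qed

lemma gam_eq_1: "s \<in> {1..N} \<Longrightarrow> 0 < is s \<Longrightarrow> gam s = 1"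
  using divisor by (auto simp: trig_divisor_def)

text \<open>The points with i_s = 0, the only ones where \<open>gam\<close> may be -1, are left out:
  Z_0^(-1) removes them from the diagonal factor, and what remains is the polynomial
  \<open>Xp\<close>.\<close>

definition inner :: "nat \<Rightarrow> nat set" where
  "inner i = {s \<in> {1..N}. 0 < is s \<and> is s < i}"

definition Xp :: "nat \<Rightarrow> K \<Rightarrow> K" where
  "Xp i y = (\<Prod>s\<in>inner i. y - constK (xs s))"

lemma lam_diff:
  assumes "1 \<le> i"
  shows "lam N is gam 1 - lam N is gam i = int (card (inner i))"
proof -
  have "{s. s \<in> {1..N} \<and> is s < i} = {s. s \<in> {1..N} \<and> is s < 1} \<union> inner i"
    using assms by (auto simp: inner_def)
  moreover have "(\<Sum>s\<in>inner i. gam s) = (\<Sum>s\<in>inner i. 1)"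
    by (intro sum.cong) (auto simp: inner_def intro: gam_eq_1)
  moreover have "sum gam ({s. s \<in> {1..N} \<and> is s < 1} \<union> inner i)
      = sum gam {s. s \<in> {1..N} \<and> is s < 1} + sum gam (inner i)"
    by (rule sum.union_disjoint) (auto simp: inner_def)
  ultimately show ?thesis
    by (simp only: lam_eq) simp
qed

lemma weight_eq:
  assumes "1 \<le> i" "i \<le> n"
  shows "lam N is gam i + mup i + mum i = int (a i) - int (a (i - 1))"
proof -
  have "lam N is gam i + mup i + mum i = (\<Sum>k=1..<n. int (a k) * alpha k i)"
    using integral assms by (simp add: integrality_def)
  also have "\<dots> = (\<Sum>k=1..<n. (if k = i then int (a k) else 0) - (if k = i - 1 then int (a k) else 0))"
    using assms by (intro sum.cong) (auto simp: alpha_def)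
  \<comment> \<open>The sum runs over 1 \<le> k < n; the terms missing at i = n and i = 1 are a_n
    and a_0, both 0.\<close>
  also have "\<dots> = int (a i) - int (a (i - 1))"
    using assms a_0 a_n by (cases "i = n"; cases "i = 1") (auto simp: sum_subtractf sum_negf sum.delta)
  finally show ?thesis .
qed

lemma mum_le:
  assumes "1 \<le> i" "i \<le> n"
  shows "mum i \<le> mum 1"
  using assms
proof (induction i rule: dec_induct)
  case (step k)
  then have "alphav k mum \<ge> 0"
    using divisor by (auto simp: trig_divisor_def dominant_def)
  then show ?case using step by (simp add: alphav_def)
qed simp

text \<open>The product over distinct points is unfolded into one over s by grouping the s with
  equal \<open>xs s\<close>; the exponent is a sum over such a group because varpi_{i_s} has
  coordinate -1 at i precisely for i_s < i.\<close>

lemma divisor_factor: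
  "(\<Prod>x\<in>xs ` {1..N}. (1 - constK x / zK) powi (- lamx N is xs gam x i))
    = (\<Prod>s | s \<in> {1..N} \<and> is s < i. (1 - constK (xs s) / zK) powi gam s)"
proof -
  have nz: "1 - constK x / zK \<noteq> 0" for x
    using zK_neq_constK[of x] by (simp add: field_simps)
  have powi_sum: "y powi (sum f I) = (\<Prod>s\<in>I. y powi f s)" if "y \<noteq> 0" for y :: K and f :: "nat \<Rightarrow> int" and I
    using that by (induction I rule: infinite_finite_induct) (auto simp: power_int_add)
  let ?h = "\<lambda>s. (1 - constK (xs s) / zK) powi (if is s < i then gam s else 0)"
  have "(1 - constK x / zK) powi (- lamx N is xs gam x i) = (\<Prod>s | s \<in> {1..N} \<and> xs s = x. ?h s)" for x
  proof -
    have "- lamx N is xs gam x i = (\<Sum>s | s \<in> {1..N} \<and> xs s = x. if is s < i then gam s else 0)"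
      unfolding lamx_def varpi_def sum_negf[symmetric] by (intro sum.cong) auto
    then have "(1 - constK x / zK) powi (- lamx N is xs gam x i)
        = (\<Prod>s | s \<in> {1..N} \<and> xs s = x. (1 - constK x / zK) powi (if is s < i then gam s else 0))"
      by (simp only: powi_sum[OF nz])
    also have "\<dots> = (\<Prod>s | s \<in> {1..N} \<and> xs s = x. ?h s)"
      by (intro prod.cong) auto
    finally show ?thesis .
  qed
  moreover have "(\<Prod>s=1..N. ?h s) = (\<Prod>x\<in>xs ` {1..N}. \<Prod>s | s \<in> {1..N} \<and> xs s = x. ?h s)"
    by (rule prod.image_gen) simp
  ultimately have "(\<Prod>x\<in>xs ` {1..N}. (1 - constK x / zK) powi (- lamx N is xs gam x i)) = (\<Prod>s=1..N. ?h s)"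
    by (simp only:)
  also have "\<dots> = (\<Prod>s=1..N. if is s < i then (1 - constK (xs s) / zK) powi gam s else 1)"
    by (intro prod.cong) auto
  also have "\<dots> = (\<Prod>s | s \<in> {1..N} \<and> is s < i. (1 - constK (xs s) / zK) powi gam s)"
    by (rule prod.inter_filter[symmetric]) simp
  finally show ?thesis .
qed

lemma divisor_factor_Z:
  assumes "1 \<le> i"
  shows "inverse (Z 0 zK) * (\<Prod>x\<in>xs ` {1..N}. (1 - constK x / zK) powi (- lamx N is xs gam x i))
    = Xp i zK / zK ^ card (inner i)"
proof -
  have nz: "1 - constK x / zK \<noteq> 0" for x
    using zK_neq_constK[of x] by (simp add: field_simps)
  let ?h = "\<lambda>s. (1 - constK (xs s) / zK) powi gam s"
  have "{s. s \<in> {1..N} \<and> is s < i} = {s \<in> {1..N}. is s = 0} \<union> inner i"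
    using assms by (auto simp: inner_def)
  then have "(\<Prod>s | s \<in> {1..N} \<and> is s < i. ?h s) = (\<Prod>s\<in>{s \<in> {1..N}. is s = 0} \<union> inner i. ?h s)"
    by simp
  also have "\<dots> = (\<Prod>s\<in>{s \<in> {1..N}. is s = 0}. ?h s) * (\<Prod>s\<in>inner i. ?h s)"
    by (rule prod.union_disjoint) (auto simp: inner_def)
  also have "(\<Prod>s\<in>{s \<in> {1..N}. is s = 0}. ?h s) = Z 0 zK"
    by (simp add: ZZ_def)
  also have "(\<Prod>s\<in>inner i. ?h s) = (\<Prod>s\<in>inner i. 1 - constK (xs s) / zK)"
    by (intro prod.cong) (auto simp: inner_def gam_eq_1)
  also have "\<dots> = Xp i zK / zK ^ card (inner i)"
    by (simp add: Xp_def prod_diff_factor[of zK])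
  finally have "(\<Prod>s | s \<in> {1..N} \<and> is s < i. ?h s) = Z 0 zK * (Xp i zK / zK ^ card (inner i))" .
  moreover have "Z 0 zK \<noteq> 0"
    using nz by (simp add: ZZ_def)
  ultimately show ?thesis
    unfolding divisor_factor by (simp only:) simp
qed

section \<open>The three factors written with linear factors in z\<close>

lemma WW_zK: "WW a k (vK powi (- m) * zK) = (\<Prod>s=1..a k. zK - vw m k s) / zK ^ a k"
proof -
  have "wK k s / (vK powi (- m) * zK) = vw m k s / zK" for s
    by (simp add: vw_def power_int_minus field_simps)
  then show ?thesis
    by (simp add: WW_def prod_diff_factor[of zK])
qed

lemma laxg_eq:
  assumes "1 \<le> i" "i \<le> n"
  shows "zK powi (lam N is gam 1 + mum 1) * inverse (Z 0 zK) * laxg N is xs gam mup a i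
    = inverse (uprod a i) * uprod a (i - 1) * zK powi (mum 1 - mum i) * Xp i zK
      * (\<Prod>s=1..a i. zK - vw (int i) i s) / (\<Prod>s=1..a (i - 1). zK - vw (int i + 1) (i - 1) s)"
proof -
  \<comment> \<open>Each factor 1 - c/z rewritten as (z - c)/z contributes to the power of z: a_i
    and \<open>card (inner i)\<close> of them in the numerator, a_{i-1} in the denominator.\<close>
  have "zK powi (lam N is gam 1 + mum 1) * zK powi mup i / zK ^ a i * zK ^ a (i - 1) / zK ^ card (inner i)
      = zK powi (lam N is gam 1 + mum 1 + mup i - int (a i) + int (a (i - 1)) - int (card (inner i)))"
    by (simp add: power_int_add power_int_diff)
  also have "lam N is gam 1 + mum 1 + mup i - int (a i) + int (a (i - 1)) - int (card (inner i))
      = mum 1 - mum i"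
    using weight_eq[OF assms] lam_diff[OF assms(1)] by simp
  finally have z: "zK powi (lam N is gam 1 + mum 1) * zK powi mup i / zK ^ a i * zK ^ a (i - 1)
      / zK ^ card (inner i) = zK powi (mum 1 - mum i)" .
  have "zK powi (lam N is gam 1 + mum 1) * inverse (Z 0 zK) * laxg N is xs gam mup a i
    = inverse (uprod a i) * uprod a (i - 1) * zK powi (lam N is gam 1 + mum 1) * zK powi mup i
      * WW a i (vK powi (- int i) * zK) / WW a (i - 1) (vK powi (- (int i + 1)) * zK)
      * (inverse (Z 0 zK) * (\<Prod>x\<in>xs ` {1..N}. (1 - constK x / zK) powi (- lamx N is xs gam x i)))"
    unfolding laxg_def uprod_def by (simp add: mult_ac)
  also have "\<dots> = inverse (uprod a i) * uprod a (i - 1)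
      * (zK powi (lam N is gam 1 + mum 1) * zK powi mup i / zK ^ a i * zK ^ a (i - 1)
      / zK ^ card (inner i)) * Xp i zK
      * (\<Prod>s=1..a i. zK - vw (int i) i s) / (\<Prod>s=1..a (i - 1). zK - vw (int i + 1) (i - 1) s)"
    unfolding divisor_factor_Z[OF assms(1)] WW_zK by (simp add: mult_ac)
  finally show ?thesis unfolding z .
qed

lemma laxf_eq:
  assumes "i \<le> \<alpha>"
  shows "laxf a \<alpha> i = (\<Sum>r\<in>(\<Pi>\<^sub>E k\<in>{i..<\<alpha>}. {1..a k}). Poly_Mapping.single (Dexp i \<alpha> r)
    (lowc a \<alpha> i r * (if i < \<alpha> then 1 / (zK - vw (int i + 2) i (r i)) else 1)))"
proof (cases "i < \<alpha>")
  case True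
  have "(- 1 :: K) powi (int i - int \<alpha> + 1) = - ((- 1) ^ (\<alpha> - i))"
  proof -
    have "int i - int \<alpha> + 1 = 1 - int (\<alpha> - i)" using True by simp
    moreover have "(- 1 :: K) powi (1 - int m) = - ((- 1) ^ m)" for m
      by (cases "even m") (simp_all add: power_int_diff)
    ultimately show ?thesis by (simp only:)
  qed
  \<comment> \<open>With c = v^(i+2) w_{i,r_i}, 1/(1 - z/c) = -c/(z - c). The sign and v^(i+2) are
    absorbed in \<open>lowc\<close>; w_{i,r_i} cancels the last denominator of f.\<close>
  moreover have "1 / (1 - zK / (vK ^ (i + 2) * wK i t))
      = - (vK powi (int i + 2) * wK i t) / (zK - vw (int i + 2) i t)" for t
  proof -
    have "vK ^ (i + 2) * wK i t = vw (int i + 2) i t"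
      by (simp add: vw_def power_int_add power2_eq_square)
    then show ?thesis
      using zK_neq_vw[of "int i + 2" i t]
      by (simp add: vw_def[symmetric] divide_simps) (simp add: algebra_simps)
  qed
  moreover have "vK powi (int i - int \<alpha>) * vK powi (int i + 2) = vK powi (2 * int i + 2 - int \<alpha>)"
    by (simp add: add_diff_eq flip: power_int_add)
  \<comment> \<open>The rearrangement is stated for arbitrary field elements so that the long
    products are treated as atoms.\<close>
  moreover have "s * V1 * inverse P / e * W1 * W2 / W3 * w / w' = s' * V3 * w * inverse P * W1 * W2 / W3 * (1 / u)"
    if "s = - s'" "1 / e = - (V2 * w') / u" "V1 * V2 = V3" "w' \<noteq> 0"
    for s s' V1 V2 V3 P e W1 W2 W3 w w' u :: K
  proof -
    have "s * V1 * inverse P / e * W1 * W2 / W3 * w / w' = s * V1 * inverse P * W1 * W2 / W3 * w / w' * (1 / e)"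
      by simp
    also have "\<dots> = s' * V3 * w * inverse P * W1 * W2 / W3 * (1 / u)"
      unfolding that(1,2) that(3)[symmetric] using that(4) by simp
    finally show ?thesis .
  qed
  ultimately show ?thesis
    using True unfolding laxf_def lowc_def uprod_def
    by (auto intro!: sum.cong arg_cong[where f = "Poly_Mapping.single _"])
next
  case False
  then show ?thesis
    using assms by (simp add: laxf_def lowc_def qsc_def)
qed

lemma laxe_eq:
  assumes "1 \<le> i" "i \<le> \<beta>"
  shows "laxe N is xs gam mup a i \<beta> = (\<Sum>r\<in>(\<Pi>\<^sub>E k\<in>{i..<\<beta>}. {1..a k}). Poly_Mapping.single (- Dexp i \<beta> r)
    (inverse (uprod a (i - 1)) * upc \<beta> i r * (if i < \<beta> then WW a (i - 1) (inverse vK * wK i (r i))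
      * (zK / (zK - vw (int i) i (r i))) else 1)))"
proof (cases "i < \<beta>")
  case True
  have "inverse (1 - vK ^ i * wK i t / zK) = zK / (zK - vw (int i) i t)" for t
    by (simp add: vw_def field_simps)
  then show ?thesis
    using True unfolding laxe_def upc_def
    by (simp add: mult_ac divide_inverse[of _ "1 - _"] uprod_def)
next
  case False
  then show ?thesis
    using assms by (simp add: laxe_def upc_def qsc_def)
qed

section \<open>Membership of the coefficients in \<open>Rset n a\<close>\<close>

lemma uK_Rset:
  assumes "k \<le> n" "t \<in> {1..a k}"
  shows "uK k t \<in> Rset n a" "inverse (uK k t) \<in> Rset n a"
proof -
  \<comment> \<open>The levels 0 and n carry no variables since a_0 = a_n = 0; so
    \<open>k \<le> n\<close> suffices as hypothesis and the boundary factors need no separate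
    treatment.\<close>
  have "k \<noteq> 0" "k \<noteq> n" using assms a_0 a_n by (auto intro: ccontr)
  then show "uK k t \<in> Rset n a" "inverse (uK k t) \<in> Rset n a"
    using assms by (auto intro: R_u R_uinv)
qed

lemma vw_Rset:
  assumes "k \<le> n" "t \<in> {1..a k}"
  shows "vw m k t \<in> Rset n a" "inverse (vw m k t) \<in> Rset n a"
  using uK_Rset[OF assms]
  by (auto simp: vw_def power_int_minus[symmetric] power_inverse[symmetric]
      intro!: R_mult Rset_vK_powi Rset.power_closed)

lemma wK_Rset:
  assumes "k \<le> n" "t \<in> {1..a k}"
  shows "wK k t \<in> Rset n a" "inverse (wK k t) \<in> Rset n a"
  using vw_Rset[OF assms, of 0] by (simp_all add: wK_eq_vw)

lemma inverse_diff_Rset: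
  assumes "k \<le> n" "s \<in> {1..a k}" "t \<in> {1..a k}" "s \<noteq> t"
  shows "inverse (vw m k t - vw m k s) \<in> Rset n a"
proof -
  have "k \<noteq> 0" "k \<noteq> n" using assms a_0 a_n by (auto intro: ccontr)
  then have "inverse (wK k t - vK powi 0 * wK k s) \<in> Rset n a"
    using assms by (intro R_loc) auto
  moreover have "inverse (vw m k t - vw m k s) = vK powi (- m) * inverse (wK k t - vK powi 0 * wK k s)"
    unfolding vw_def right_diff_distrib[symmetric] by (simp add: power_int_minus)
  ultimately show ?thesis by (auto intro: R_mult Rset_vK_powi)
qed

lemma uprod_Rset:
  assumes "k \<le> n"
  shows "uprod a k \<in> Rset n a" "inverse (uprod a k) \<in> Rset n a"
  unfolding uprod_def using uK_Rset[OF assms]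
  by (auto intro!: Rset.prod_closed Rset.inverse_prod_closed)

lemma WW_Rset: "k \<le> n \<Longrightarrow> inverse y \<in> Rset n a \<Longrightarrow> WW a k y \<in> Rset n a"
  unfolding WW_def by (intro Rset.prod_closed Rset.diff_closed Rset.one_closed Rset.divide_closed wK_Rset)

lemma WWr_Rset: "k \<le> n \<Longrightarrow> inverse y \<in> Rset n a \<Longrightarrow> WWr a k r y \<in> Rset n a"
  unfolding WWr_def by (intro Rset.prod_closed Rset.diff_closed Rset.one_closed Rset.divide_closed wK_Rset) auto

lemma inverse_WWr_Rset:
  assumes "k \<le> n" "r \<in> {1..a k}"
  shows "inverse (WWr a k r (wK k r)) \<in> Rset n a"
  unfolding WWr_def
proof (rule Rset.inverse_prod_closed)
  fix s assume s: "s \<in> {1..a k} - {r}"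
  have "inverse (1 - wK k s / wK k r) = wK k r * inverse (vw 0 k r - vw 0 k s)"
    by (simp add: wK_eq_vw field_simps)
  then show "inverse (1 - wK k s / wK k r) \<in> Rset n a"
    using s assms by (auto intro!: R_mult wK_Rset inverse_diff_Rset)
qed

text \<open>For k \<ge> 1 all exponents \<open>gam s\<close> in this product are 1, so no factor has
  to be inverted.\<close>

lemma Z_Rset:
  assumes "1 \<le> k" "inverse y \<in> Rset n a"
  shows "Z k y \<in> Rset n a"
  unfolding ZZ_def
proof (rule Rset.prod_closed)
  fix s assume "s \<in> {s \<in> {1..N}. is s = k}"
  then have "gam s = 1" using assms gam_eq_1 by auto
  then show "(1 - vK powi (- int k) * constK (xs s) / y) powi gam s \<in> Rset n a"
    using assms by (auto intro!: Rset.diff_closed Rset.divide_closed R_mult Rset_vK_powi R_const)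
qed

lemma vK_power_Rset: "vK ^ k \<in> Rset n a" "inverse (vK ^ k) \<in> Rset n a"
  by (auto simp: power_inverse[symmetric] intro: Rset.power_closed R_v R_vinv)

lemma lowc_Rset:
  assumes "\<alpha> \<le> n" "\<And>k. k \<in> {i..<\<alpha>} \<Longrightarrow> r k \<in> {1..a k}"
  shows "lowc a \<alpha> i r \<in> Rset n a"
proof (cases "i < \<alpha>")
  case True
  have w: "wK k (r k) \<in> Rset n a" "inverse (wK k (r k)) \<in> Rset n a"
    "inverse (WWr a k (r k) (wK k (r k))) \<in> Rset n a" if "i \<le> k" "k < \<alpha>" for k
    using assms(1) assms(2)[of k] that by (auto intro!: wK_Rset inverse_WWr_Rset)
  have v: "inverse (vK * wK k (r k)) \<in> Rset n a" if "i \<le> k" "k < \<alpha>" for k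
    using w[OF that] by (auto intro!: R_mult R_vinv)
  have "(\<Prod>k=i+1..<\<alpha>. WWr a k (r k) (vK * wK (k - 1) (r (k - 1)))) \<in> Rset n a"
    using assms(1) by (intro Rset.prod_closed WWr_Rset v) auto
  moreover have "WW a \<alpha> (vK * wK (\<alpha> - 1) (r (\<alpha> - 1))) \<in> Rset n a"
    using True assms(1) by (intro WW_Rset v) auto
  moreover have "inverse (\<Prod>k=i+1..\<alpha>. uprod a k) \<in> Rset n a"
    using assms(1) by (intro Rset.inverse_prod_closed uprod_Rset) auto
  moreover have "inverse (\<Prod>k=i..<\<alpha>. WWr a k (r k) (wK k (r k))) \<in> Rset n a"
    by (intro Rset.inverse_prod_closed w) auto
  moreover have "wK (\<alpha> - 1) (r (\<alpha> - 1)) \<in> Rset n a"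
    using True by (intro w) auto
  moreover have "(- 1) ^ (\<alpha> - i) \<in> Rset n a"
    by (intro Rset.power_closed Rset.uminus_closed Rset.one_closed)
  ultimately show ?thesis
    using True unfolding lowc_def by (auto intro!: R_mult Rset.divide_closed Rset_vK_powi)
qed (simp add: lowc_def)

lemma upc_Rset:
  assumes "1 \<le> i" "\<beta> \<le> n" "\<And>k. k \<in> {i..<\<beta>} \<Longrightarrow> r k \<in> {1..a k}"
  shows "upc \<beta> i r \<in> Rset n a"
proof (cases "i < \<beta>")
  case True
  have w: "wK k (r k) \<in> Rset n a" "inverse (wK k (r k)) \<in> Rset n a"
    "inverse (WWr a k (r k) (wK k (r k))) \<in> Rset n a" if "i \<le> k" "k < \<beta>" for k
    using assms(2) assms(3)[of k] that by (auto intro!: wK_Rset inverse_WWr_Rset)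
  have v: "inverse (inverse vK * wK k (r k)) \<in> Rset n a" if "i \<le> k" "k < \<beta>" for k
    using w[OF that] by (auto intro!: R_mult R_v)
  have "(\<Prod>k=i..\<beta> - 2. WWr a k (r k) (inverse vK * wK (k + 1) (r (k + 1)))) \<in> Rset n a"
    using True assms by (intro Rset.prod_closed WWr_Rset v) auto
  moreover have "(\<Prod>k=i..\<beta> - 2. uprod a k) \<in> Rset n a"
    using assms(2) by (intro Rset.prod_closed uprod_Rset) auto
  moreover have "(\<Prod>t=1..a (\<beta> - 1). wK (\<beta> - 1) t) \<in> Rset n a"
    using assms(2) by (intro Rset.prod_closed wK_Rset) auto
  moreover have "inverse (\<Prod>k=i..<\<beta>. WWr a k (r k) (wK k (r k))) \<in> Rset n a"
    by (intro Rset.inverse_prod_closed w) auto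
  moreover have "(\<Prod>k=i..<\<beta>. Z k (wK k (r k))) \<in> Rset n a"
    using assms(1) by (intro Rset.prod_closed Z_Rset w) auto
  moreover have "(\<Prod>k=i..<\<beta>. (vK ^ k * wK k (r k)) powi (- alphav k mup)) \<in> Rset n a"
    unfolding power_int_mult_distrib
    by (intro Rset.prod_closed R_mult Rset.power_int_closed vK_power_Rset w) auto
  moreover have "wK i (r i) \<in> Rset n a" "inverse (wK (\<beta> - 1) (r (\<beta> - 1))) \<in> Rset n a"
    using True by (intro w; simp)+
  moreover have "(- 1) powi (int i - int \<beta> + 1) \<in> Rset n a"
    using Rset.uminus_closed[OF Rset.one_closed]
    by (intro Rset.power_int_closed) simp_all
  ultimately show ?thesis
    using True unfolding upc_def by (auto intro!: R_mult Rset.divide_closed)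
next
  case False
  then show ?thesis using assms by (simp add: upc_def uprod_Rset)
qed

section \<open>Cancellation of residues\<close>

text \<open>One point in two roles: the zero of the denominator W_{i-1} for i = j + 1, and the pole
  at coinciding indices for i = j.\<close>

definition pole :: "nat \<Rightarrow> nat \<Rightarrow> K" where
  "pole j t = vw (int j + 2) j t"

text \<open>The zeros in z of the numerator W_i(v^(-i) z) after the D's of f have been moved past
  it.\<close>

definition shifted_root :: "nat \<Rightarrow> nat \<Rightarrow> (nat \<Rightarrow> nat) \<Rightarrow> nat \<Rightarrow> K" where
  "shifted_root \<alpha> i r s = sigmaK (Dexp i \<alpha> r) (vw (int i) i s)"

definition scalar :: "nat \<Rightarrow> nat \<Rightarrow> nat \<Rightarrow> (nat \<Rightarrow> nat) \<Rightarrow> (nat \<Rightarrow> nat) \<Rightarrow> K" where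
  "scalar \<alpha> \<beta> i r r' = lowc a \<alpha> i r * inverse (sigmaK (Dexp i \<alpha> r) (uprod a i))
     * sigmaK (Dexp i \<alpha> r) (upc \<beta> i r')"

text \<open>A function of \<open>y\<close> and not a polynomial, so that one formula serves both at
  \<open>zK\<close> and at the poles; away from the shifted roots its quotients reduce.\<close>

definition numer :: "nat \<Rightarrow> nat \<Rightarrow> nat \<Rightarrow> (nat \<Rightarrow> nat) \<Rightarrow> (nat \<Rightarrow> nat) \<Rightarrow> K \<Rightarrow> K" where
  "numer \<alpha> \<beta> i r r' y = scalar \<alpha> \<beta> i r r'
     * (if i < \<beta> then (\<Prod>s=1..a (i - 1). 1 - pole (i - 1) s / shifted_root \<alpha> i r (r' i))
          * (y / (y - shifted_root \<alpha> i r (r' i))) else 1)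
     * (y powi (mum 1 - mum i) * Xp i y)
     * ((\<Prod>s=1..a i. y - shifted_root \<alpha> i r s) * (if i < \<alpha> then 1 / (y - shifted_root \<alpha> i r (r i)) else 1))"

definition summand :: "nat \<Rightarrow> nat \<Rightarrow> nat \<Rightarrow> (nat \<Rightarrow> nat) \<Rightarrow> (nat \<Rightarrow> nat) \<Rightarrow> K" where
  "summand \<alpha> \<beta> i r r' = numer \<alpha> \<beta> i r r' zK / (\<Prod>s=1..a (i - 1). zK - pole (i - 1) s)"

definition upper_res :: "nat \<Rightarrow> nat \<Rightarrow> nat \<Rightarrow> (nat \<Rightarrow> nat) \<Rightarrow> (nat \<Rightarrow> nat) \<Rightarrow> nat \<Rightarrow> K" where
  "upper_res \<alpha> \<beta> i r r' t = numer \<alpha> \<beta> i r r' (pole (i - 1) t)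
     / (\<Prod>s\<in>{1..a (i - 1)} - {t}. pole (i - 1) t - pole (i - 1) s)"

text \<open>The power of the pole in the denominator is what remains of the factor W_{i-1} of e
  divided by the denominator of g: the products of cross-level differences cancel. The + 1 in the
  exponent comes from the numerator of y/(y - \<eta>).\<close>

definition diag_res :: "nat \<Rightarrow> nat \<Rightarrow> nat \<Rightarrow> (nat \<Rightarrow> nat) \<Rightarrow> (nat \<Rightarrow> nat) \<Rightarrow> K" where
  "diag_res \<alpha> \<beta> i r r' = scalar \<alpha> \<beta> i r r' / pole i (r i) ^ a (i - 1)
     * (pole i (r i) powi (mum 1 - mum i + 1) * Xp i (pole i (r i)))
     * (\<Prod>s\<in>{1..a i} - {r i}. pole i (r i) - shifted_root \<alpha> i r s)"

lemma shifted_root_eq: "shifted_root \<alpha> i r s = vw (int i + 2 * Poly_Mapping.lookup (Dexp i \<alpha> r) (i, s)) i s"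
  by (simp add: shifted_root_def sigmaK_vw)

lemma shifted_root_diag: "i < \<alpha> \<Longrightarrow> shifted_root \<alpha> i r (r i) = pole i (r i)"
  by (simp add: shifted_root_eq pole_def lookup_Dexp)

lemma laxTn_eq:
  assumes "\<alpha> \<le> n"
  shows "laxTn N is xs gam mup mum a \<alpha> \<beta> = (\<Sum>i=1..min \<alpha> \<beta>.
    \<Sum>r\<in>(\<Pi>\<^sub>E k\<in>{i..<\<alpha>}. {1..a k}). \<Sum>r'\<in>(\<Pi>\<^sub>E k\<in>{i..<\<beta>}. {1..a k}).
      Poly_Mapping.single (Dexp i \<alpha> r - Dexp i \<beta> r') (summand \<alpha> \<beta> i r r'))"
proof -
  define c where "c = zK powi (lam N is gam 1 + mum 1) * inverse (Z 0 zK)"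
  have c_fix: "sigmaK d c = c" for d
    by (simp add: c_def sigmaK_hom sigmaK_Z)
  have "laxTn N is xs gam mup mum a \<alpha> \<beta> = (\<Sum>i=1..min \<alpha> \<beta>. qmul (qsc c)
      (qmul (qmul (laxf a \<alpha> i) (qsc (laxg N is xs gam mup a i))) (laxe N is xs gam mup a i \<beta>)))"
    unfolding laxTn_def laxT_def c_def qmul_sum_right ..
  also have "\<dots> = (\<Sum>i=1..min \<alpha> \<beta>.
    \<Sum>r\<in>(\<Pi>\<^sub>E k\<in>{i..<\<alpha>}. {1..a k}). \<Sum>r'\<in>(\<Pi>\<^sub>E k\<in>{i..<\<beta>}. {1..a k}).
      Poly_Mapping.single (Dexp i \<alpha> r - Dexp i \<beta> r') (summand \<alpha> \<beta> i r r'))"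
  proof (rule sum.cong[OF refl])
    fix i assume "i \<in> {1..min \<alpha> \<beta>}"
    then have i: "1 \<le> i" "i \<le> \<alpha>" "i \<le> \<beta>" "i \<le> n" using assms by auto
    define F where "F r = (if i < \<alpha> then 1 / (zK - vw (int i + 2) i (r i)) else 1)" for r :: "nat \<Rightarrow> nat"
    define E where "E r = (if i < \<beta> then WW a (i - 1) (inverse vK * wK i (r i))
      * (zK / (zK - vw (int i) i (r i))) else 1)" for r :: "nat \<Rightarrow> nat"
    have coeff: "c * (lowc a \<alpha> i r * F r * sigmaK (Dexp i \<alpha> r) (laxg N is xs gam mup a i)
        * sigmaK (Dexp i \<alpha> r) (inverse (uprod a (i - 1)) * upc \<beta> i r' * E r')) = summand \<alpha> \<beta> i r r'"
      for r r'
    proof -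
      let ?\<sigma> = "sigmaK (Dexp i \<alpha> r)"
      \<comment> \<open>The D's of f have level at least i, so the poles coming from W_{i-1} are not
        shifted.\<close>
      have low: "Poly_Mapping.lookup (Dexp i \<alpha> r) (i - 1, s) = 0" for s
        using i(1) by (auto simp: lookup_Dexp)
      have "c * ?\<sigma> (laxg N is xs gam mup a i) = ?\<sigma> (c * laxg N is xs gam mup a i)"
        by (simp add: sigmaK_mult c_fix)
      also have "\<dots> = ?\<sigma> (inverse (uprod a i) * uprod a (i - 1) * zK powi (mum 1 - mum i) * Xp i zK
          * (\<Prod>s=1..a i. zK - vw (int i) i s) / (\<Prod>s=1..a (i - 1). zK - vw (int i + 1) (i - 1) s))"
        using laxg_eq[OF i(1,4)] by (simp only: c_def)
      also have "\<dots> = inverse (?\<sigma> (uprod a i)) * ?\<sigma> (uprod a (i - 1)) * zK powi (mum 1 - mum i) * Xp i zK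
          * (\<Prod>s=1..a i. zK - shifted_root \<alpha> i r s) / (\<Prod>s=1..a (i - 1). zK - pole (i - 1) s)"
      proof -
        have "?\<sigma> (vw (int i + 1) (i - 1) s) = pole (i - 1) s" for s
          using i(1) by (simp only: sigmaK_vw low pole_def) (simp add: of_nat_diff add.commute)
        then show ?thesis
          by (simp add: sigmaK_hom shifted_root_def Xp_def)
      qed
      finally have g: "c * ?\<sigma> (laxg N is xs gam mup a i) = \<dots>" .
      have E: "?\<sigma> (E r') = (if i < \<beta> then (\<Prod>s=1..a (i - 1). 1 - pole (i - 1) s / shifted_root \<alpha> i r (r' i))
          * (zK / (zK - shifted_root \<alpha> i r (r' i))) else 1)"
      proof -
        have "?\<sigma> (WW a (i - 1) (inverse vK * wK i (r' i)))
            = (\<Prod>s=1..a (i - 1). 1 - pole (i - 1) s / shifted_root \<alpha> i r (r' i))"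
          unfolding WW_def sigmaK_prod
        proof (rule prod.cong[OF refl])
          fix s
          have "?\<sigma> (1 - wK (i - 1) s / (inverse vK * wK i (r' i)))
            = 1 - vw 0 (i - 1) s / vw (2 * Poly_Mapping.lookup (Dexp i \<alpha> r) (i, r' i) - 1) i (r' i)"
            by (simp add: wK_eq_vw vK_mult_vw sigmaK_diff sigmaK_divide sigmaK_vw low[unfolded One_nat_def])
          also have "vw 0 (i - 1) s / vw (2 * Poly_Mapping.lookup (Dexp i \<alpha> r) (i, r' i) - 1) i (r' i)
            = pole (i - 1) s / shifted_root \<alpha> i r (r' i)"
            unfolding pole_def shifted_root_eq vw_divide_vw using i(1) by (simp add: of_nat_diff)
          finally show "?\<sigma> (1 - wK (i - 1) s / (inverse vK * wK i (r' i)))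
            = 1 - pole (i - 1) s / shifted_root \<alpha> i r (r' i)" .
        qed
        then show ?thesis
          by (simp add: E_def sigmaK_mult sigmaK_divide sigmaK_diff shifted_root_def)
      qed
      have F: "F r = (if i < \<alpha> then 1 / (zK - shifted_root \<alpha> i r (r i)) else 1)"
        by (simp add: F_def shifted_root_diag) (simp add: pole_def)
      have "c * (lowc a \<alpha> i r * F r * ?\<sigma> (laxg N is xs gam mup a i)
          * ?\<sigma> (inverse (uprod a (i - 1)) * upc \<beta> i r' * E r'))
        = lowc a \<alpha> i r * F r * (c * ?\<sigma> (laxg N is xs gam mup a i))
          * (inverse (?\<sigma> (uprod a (i - 1))) * ?\<sigma> (upc \<beta> i r') * ?\<sigma> (E r'))"
        by (simp add: sigmaK_mult sigmaK_inverse mult_ac)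
      moreover have "?\<sigma> (uprod a (i - 1)) \<noteq> 0"
        by (simp add: sigmaK_uprod)
      ultimately show ?thesis
        unfolding g E F summand_def numer_def scalar_def by (simp add: mult_ac)
    qed
    show "qmul (qsc c) (qmul (qmul (laxf a \<alpha> i) (qsc (laxg N is xs gam mup a i))) (laxe N is xs gam mup a i \<beta>))
      = (\<Sum>r\<in>(\<Pi>\<^sub>E k\<in>{i..<\<alpha>}. {1..a k}). \<Sum>r'\<in>(\<Pi>\<^sub>E k\<in>{i..<\<beta>}. {1..a k}).
      Poly_Mapping.single (Dexp i \<alpha> r - Dexp i \<beta> r') (summand \<alpha> \<beta> i r r'))"
      unfolding laxf_eq[OF i(2)] laxe_eq[OF i(1,3)] F_def[symmetric] E_def[symmetric] qsc_def
        qmul_sum_left qmul_sum_right qmul_single coeff[symmetric]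
      by (subst sum.swap) (simp add: mult_ac)
  qed
  finally show ?thesis .
qed

lemma pole_nonzero [simp]: "pole j t \<noteq> 0"
  by (simp add: pole_def)

text \<open>The residue is divided into the parts covered by \<open>lower_residue\<close> and
  \<open>upper_residue\<close> and the polynomial \<open>Xp\<close>. Their factors v cancel, the
  value of Z_j is absorbed by the growth of \<open>Xp\<close> from j to j + 1, and the sign comes
  from the lower part.\<close>

lemma residues_cancel:
  assumes "1 \<le> j" "Suc j \<le> \<alpha>" "Suc j \<le> \<beta>" "\<alpha> \<le> n" "t \<in> {1..a j}"
    "Suc j < \<alpha> \<Longrightarrow> r (Suc j) \<in> {1..a (Suc j)}"
  shows "upper_res \<alpha> \<beta> (Suc j) r r' t = - diag_res \<alpha> \<beta> j (r(j := t)) (r'(j := t))"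
proof -
  define d where "d = Dexp (Suc j) \<alpha> r"
  define d' where "d' = d + Poly_Mapping.single (j, t) 1"
  define \<zeta> where "\<zeta> = pole j t"
  define L where "L = lowc a \<alpha> j (r(j := t))"
  define U where "U = sigmaK d' (inverse (uprod a j) * upc \<beta> j (r'(j := t)))"
  define W where "W = WWr a j t (wK j t)"
  define W2 where "W2 = WWr a j t (vw 2 j t)"
  define ZZ2 where "ZZ2 = Z j (vw 2 j t)"
  define E where "E = (if Suc j < \<beta> then (\<Prod>s=1..a j. 1 - pole j s / shifted_root \<alpha> (Suc j) r (r' (Suc j)))
          * (\<zeta> / (\<zeta> - shifted_root \<alpha> (Suc j) r (r' (Suc j)))) else 1)"
  define m where "m = card {s \<in> {1..N}. is s = j}"
  have d'_eq: "Dexp j \<alpha> (r(j := t)) = d'"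
    using assms by (simp add: Dexp_step d_def d'_def)
  have \<zeta>0: "\<zeta> \<noteq> 0" by (simp add: \<zeta>_def)
  have low: "lowc a \<alpha> (Suc j) r * inverse (sigmaK d (uprod a (Suc j)))
     * ((\<Prod>s=1..a (Suc j). \<zeta> - shifted_root \<alpha> (Suc j) r s)
         * (if Suc j < \<alpha> then 1 / (\<zeta> - shifted_root \<alpha> (Suc j) r (r (Suc j))) else 1))
   = - vK * \<zeta> powi (int (a (Suc j)) - 1) * L * W"
    unfolding L_def W_def
    by (rule lower_residue) (use assms in \<open>auto simp: d_def \<zeta>_def pole_def shifted_root_def\<close>)
  have up: "U = vK * \<zeta> powi (- alphav j mup) * ZZ2 / W2 * sigmaK d (upc \<beta> (Suc j) r') * E"
    unfolding U_def ZZ2_def W2_def E_def pole_def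
    by (rule upper_residue) (use assms in \<open>auto simp: d'_def \<zeta>_def pole_def d_def shifted_root_def lookup_Dexp\<close>)
  have nz: "W \<noteq> 0" "W2 \<noteq> 0"
    unfolding W_def W2_def wK_eq_vw by (rule WWr_nonzero; force)+
  \<comment> \<open>Since v^j times v^2 w_{j,t} is \<open>\<zeta>\<close>, the shift v^(-j) built
    into Z_j turns its factors into 1 - x_s/\<zeta>, the ones that distinguish
    \<open>Xp (Suc j)\<close> from \<open>Xp j\<close>.\<close>
  have Zj: "ZZ2 = (\<Prod>s | s \<in> {1..N} \<and> is s = j. 1 - constK (xs s) / \<zeta>)"
    unfolding ZZ2_def ZZ_def
  proof (intro prod.cong)
    fix s assume "s \<in> {s. s \<in> {1..N} \<and> is s = j}"
    then have "gam s = 1" using assms gam_eq_1 by auto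
    then show "(1 - vK powi (- int j) * constK (xs s) / vw 2 j t) powi gam s = 1 - constK (xs s) / \<zeta>"
      by (simp add: \<zeta>_def pole_def vw_def power_int_minus power_int_add field_simps)
  qed auto
  have "\<zeta> \<noteq> constK x" for x
    by (simp add: \<zeta>_def pole_def vw_neq_constK)
  then have Z0: "ZZ2 \<noteq> 0" using \<zeta>0 by (auto simp: Zj)
  have X: "Xp (Suc j) \<zeta> = Xp j \<zeta> * \<zeta> powi int m * ZZ2"
  proof -
    have inner: "inner (Suc j) = inner j \<union> {s \<in> {1..N}. is s = j}"
      using assms by (auto simp: inner_def)
    have "Xp (Suc j) \<zeta> = Xp j \<zeta> * (\<Prod>s\<in>{s \<in> {1..N}. is s = j}. \<zeta> - constK (xs s))"
      unfolding Xp_def inner by (rule prod.union_disjoint) (auto simp: inner_def)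
    then show ?thesis
      using prod_diff_factor[OF \<zeta>0, of "\<lambda>s. constK (xs s)" "{s \<in> {1..N}. is s = j}"]
      by (simp add: Zj m_def)
  qed
  have m: "int m = lam N is gam j - lam N is gam (Suc j)"
  proof -
    have "card (inner (Suc j)) = card (inner j) + m"
      unfolding m_def by (subst card_Un_disjoint[symmetric]) (use assms in \<open>auto simp: inner_def intro!: arg_cong[where f = card]\<close>)
    then show ?thesis
      using lam_diff[of j] lam_diff[of "Suc j"] assms(1) by simp
  qed
  have Q: "(\<Prod>s\<in>{1..a j} - {t}. \<zeta> - pole j s) = \<zeta> powi (int (a j) - 1) * W"
    using WWr_prod[of t a j "int j + 2" j t "int j + 2"] assms(5)
    by (simp add: \<zeta>_def pole_def W_def wK_eq_vw)
  have R: "(\<Prod>s\<in>{1..a j} - {t}. \<zeta> - shifted_root \<alpha> j (r(j := t)) s) = \<zeta> powi (int (a j) - 1) * W2"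
  proof -
    have "(\<Prod>s\<in>{1..a j} - {t}. \<zeta> - shifted_root \<alpha> j (r(j := t)) s) = (\<Prod>s\<in>{1..a j} - {t}. vw (int j + 2) j t - vw (int j) j s)"
      by (intro prod.cong) (auto simp: \<zeta>_def pole_def shifted_root_eq lookup_Dexp)
    then show ?thesis
      using WWr_prod[of t a j "int j + 2" j t "int j"] assms(5)
      by (simp add: \<zeta>_def pole_def W2_def)
  qed
  have S: "scalar \<alpha> \<beta> j (r(j := t)) (r'(j := t)) = L * U"
    unfolding scalar_def d'_eq by (simp add: L_def U_def sigmaK_mult sigmaK_inverse)
  \<comment> \<open>Integrality in coordinate j + 1 eliminates a_{j+1}, and in coordinate j it
    brings in a_{j-1}.\<close>
  have exps: "\<zeta> powi (int (a (Suc j)) - 1) * \<zeta> powi alphav j mup * \<zeta> powi (mum 1 - mum (Suc j)) * \<zeta> powi int m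
      = \<zeta> powi (int (a j) - 1) * (\<zeta> powi (mum 1 - mum j + 1) / \<zeta> ^ a (j - 1)) * \<zeta> powi (int (a j) - 1)"
  proof -
    have "\<zeta> powi (int (a (Suc j)) - 1) * \<zeta> powi alphav j mup * \<zeta> powi (mum 1 - mum (Suc j)) * \<zeta> powi int m
      = \<zeta> powi (int (a (Suc j)) - 1 + alphav j mup + (mum 1 - mum (Suc j)) + int m)"
      using \<zeta>0 by (simp add: power_int_add)
    also have "int (a (Suc j)) - 1 + alphav j mup + (mum 1 - mum (Suc j)) + int m
      = (int (a j) - 1) + (mum 1 - mum j + 1 - int (a (j - 1))) + (int (a j) - 1)"
      using weight_eq[of j] weight_eq[of "Suc j"] assms m by (simp add: alphav_def)
    also have "\<zeta> powi (k + (l - int p) + q) = \<zeta> powi k * (\<zeta> powi l / \<zeta> ^ p) * \<zeta> powi q" for k l p q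
      using \<zeta>0 by (simp add: power_int_add power_int_diff)
    finally show ?thesis .
  qed
  have up': "sigmaK d (upc \<beta> (Suc j) r') * E = U * W2 * \<zeta> powi alphav j mup / (vK * ZZ2)"
    using nz Z0 \<zeta>0 unfolding up by (simp add: power_int_minus field_simps)
  have "numer \<alpha> \<beta> (Suc j) r r' \<zeta> = (lowc a \<alpha> (Suc j) r * inverse (sigmaK d (uprod a (Suc j)))
     * ((\<Prod>s=1..a (Suc j). \<zeta> - shifted_root \<alpha> (Suc j) r s)
         * (if Suc j < \<alpha> then 1 / (\<zeta> - shifted_root \<alpha> (Suc j) r (r (Suc j))) else 1)))
     * (sigmaK d (upc \<beta> (Suc j) r') * E) * (\<zeta> powi (mum 1 - mum (Suc j)) * Xp (Suc j) \<zeta>)"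
    unfolding numer_def scalar_def d_def[symmetric] E_def diff_Suc_1 by (simp only: mult_ac)
  also have "\<dots> = - L * W * U * W2 * Xp j \<zeta> * (\<zeta> powi (int (a (Suc j)) - 1) * \<zeta> powi alphav j mup
      * \<zeta> powi (mum 1 - mum (Suc j)) * \<zeta> powi int m)"
    unfolding low up' X using Z0 by simp
  finally have num: "numer \<alpha> \<beta> (Suc j) r r' \<zeta> = - L * W * U * W2 * Xp j \<zeta>
      * (\<zeta> powi (int (a j) - 1) * (\<zeta> powi (mum 1 - mum j + 1) / \<zeta> ^ a (j - 1)) * \<zeta> powi (int (a j) - 1))"
    unfolding exps .
  have "upper_res \<alpha> \<beta> (Suc j) r r' t = numer \<alpha> \<beta> (Suc j) r r' \<zeta> / (\<zeta> powi (int (a j) - 1) * W)"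
    unfolding upper_res_def diff_Suc_1 \<zeta>_def[symmetric] Q ..
  also have "\<dots> = - (L * U * W2 * Xp j \<zeta> * (\<zeta> powi (mum 1 - mum j + 1) / \<zeta> ^ a (j - 1)) * \<zeta> powi (int (a j) - 1))"
    unfolding num using nz \<zeta>0 by simp
  also have "\<dots> = - diag_res \<alpha> \<beta> j (r(j := t)) (r'(j := t))"
    unfolding diag_res_def fun_upd_same \<zeta>_def[symmetric] R S by simp
  finally show ?thesis .
qed

section \<open>The regular part of a summand\<close>

definition regular :: "nat \<Rightarrow> nat \<Rightarrow> nat \<Rightarrow> (nat \<Rightarrow> nat) \<Rightarrow> (nat \<Rightarrow> nat) \<Rightarrow> K" where
  "regular \<alpha> \<beta> i r r' = summand \<alpha> \<beta> i r r'
     - (\<Sum>t=1..a (i - 1). upper_res \<alpha> \<beta> i r r' t / (zK - pole (i - 1) t))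
     - (if i < \<alpha> \<and> i < \<beta> \<and> r i = r' i then diag_res \<alpha> \<beta> i r r' / (zK - pole i (r i)) else 0)"

lemma zK_neq_pole: "zK \<noteq> pole j t"
  by (simp add: pole_def zK_neq_vw)

lemma shifted_root_neq: "zK \<noteq> shifted_root \<alpha> i r s" "1 \<le> i \<Longrightarrow> pole (i - 1) t \<noteq> shifted_root \<alpha> i r s" "shifted_root \<alpha> i r s \<noteq> 0"
  by (auto simp: shifted_root_eq zK_neq_vw pole_def dest: vw_eqD)

lemma shifted_root_Rset:
  assumes "i \<le> n" "s \<in> {1..a i}"
  shows "shifted_root \<alpha> i r s \<in> Rset n a" "inverse (shifted_root \<alpha> i r s) \<in> Rset n a"
  unfolding shifted_root_eq using assms by (auto intro: vw_Rset)

lemma pole_Rset: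
  assumes "i \<le> n" "s \<in> {1..a i}"
  shows "pole i s \<in> Rset n a"
  unfolding pole_def using assms by (auto intro: vw_Rset)

lemma scalar_Rset:
  assumes "1 \<le> i" "i \<le> n" "\<alpha> \<le> n" "\<beta> \<le> n"
    "r \<in> (\<Pi>\<^sub>E k\<in>{i..<\<alpha>}. {1..a k})" "r' \<in> (\<Pi>\<^sub>E k\<in>{i..<\<beta>}. {1..a k})"
  shows "scalar \<alpha> \<beta> i r r' \<in> Rset n a"
  unfolding scalar_def sigmaK_inverse[symmetric]
  using assms by (intro R_mult sigmaK_Rset lowc_Rset upc_Rset uprod_Rset) (auto dest: PiE_mem)

text \<open>If r_i = r'_i for i < \<alpha>, \<beta>, the zero of W_i cancels only one of two equal
  denominators, and the values of W_{i-1} provide the numerator demanded by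
  \<open>partial_fractions_extra_pole\<close>. Otherwise both denominators cancel against different
  zeros and \<open>partial_fractions\<close> suffices.\<close>

lemma regular_Rzset:
  assumes i: "1 \<le> i" "i \<le> \<alpha>" "i \<le> \<beta>" and n: "\<alpha> \<le> n" "\<beta> \<le> n"
    and r: "r \<in> (\<Pi>\<^sub>E k\<in>{i..<\<alpha>}. {1..a k})" and r': "r' \<in> (\<Pi>\<^sub>E k\<in>{i..<\<beta>}. {1..a k})"
  shows "regular \<alpha> \<beta> i r r' \<in> Rzset n a"
proof -
  let ?R = "Rset n a" and ?I = "{1..a (i - 1)}" and ?\<zeta> = "pole (i - 1)" and ?\<eta> = "shifted_root \<alpha> i r"
  have ri: "r i \<in> {1..a i}" if "i < \<alpha>" using r that by (auto dest!: PiE_mem[of _ _ _ i])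
  have ri': "r' i \<in> {1..a i}" if "i < \<beta>" using r' that by (auto dest!: PiE_mem[of _ _ _ i])
  have in': "i \<le> n" using i n by simp
  define S where "S = scalar \<alpha> \<beta> i r r'"
  have S: "S \<in> ?R"
    unfolding S_def using assms in' by (intro scalar_Rset) auto
  \<comment> \<open>The common form of the numerators in both cases; \<open>nat\<close> loses
    nothing since mum_1 - mum_i \<ge> 0 by dominance.\<close>
  define P where "P C e M = smult C (monom 1 (nat (mum 1 - mum i) + e)
      * (\<Prod>s\<in>inner i. [:- constK (xs s), 1:]) * (\<Prod>s\<in>M. [:- ?\<eta> s, 1:]))" for C :: K and e M
  have poly_P: "poly (P C e M) y = C * (y powi (mum 1 - mum i) * y ^ e * Xp i y) * (\<Prod>s\<in>M. y - ?\<eta> s)" for C e M y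
  proof -
    have "y powi (mum 1 - mum i) = y ^ nat (mum 1 - mum i)"
      using mum_le[OF i(1) in'] by (simp add: power_int_def)
    then show ?thesis
      by (simp add: P_def poly_monom poly_prod Xp_def power_add mult_ac)
  qed
  have P_over: "P C e M \<in> polys_over ?R" if "C \<in> ?R" "M \<subseteq> {1..a i}" for C e M
    unfolding P_def using that
    by (intro Rset.polys_over_smult Rset.polys_over_mult Rset.polys_over_monom Rset.polys_over_prod
        Rset.polys_over_linear R_const shifted_root_Rset in') auto
  have inj: "inj_on ?\<zeta> ?I"
    by (auto simp: inj_on_def pole_def dest: vw_eqD)
  have \<zeta>: "?\<zeta> t \<in> ?R" if "t \<in> ?I" for t
    using that in' by (auto intro: pole_Rset)
  have inv: "inverse (?\<zeta> t - ?\<zeta> s) \<in> ?R" if "s \<in> ?I" "t \<in> ?I" "s \<noteq> t" for s t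
    unfolding pole_def using that in' by (intro inverse_diff_Rset) auto
  have remove: "(\<Prod>s\<in>M. y - ?\<eta> s) * (1 / (y - ?\<eta> u)) = (\<Prod>s\<in>M - {u}. y - ?\<eta> s)"
    if "u \<in> M" "finite M" "y \<noteq> ?\<eta> u" for y M u
    using that by (simp add: prod.remove)
  show ?thesis
  proof (cases "i < \<alpha> \<and> i < \<beta> \<and> r i = r' i")
    case True
    then have ab: "i < \<alpha>" "i < \<beta>" "r' i = r i" by auto
    define \<eta> where "\<eta> = pole i (r i)"
    have \<eta>: "?\<eta> (r i) = \<eta>" using ab by (simp add: \<eta>_def shifted_root_diag)
    have \<eta>0: "\<eta> \<noteq> 0" by (simp add: \<eta>_def)
    define p where "p = P (S / \<eta> ^ a (i - 1)) 1 ({1..a i} - {r i})"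
    have \<eta>R: "\<eta> \<in> ?R" "inverse \<eta> \<in> ?R"
      using shifted_root_Rset[OF in' ri] ab unfolding \<eta>[symmetric] by auto
    have p: "p \<in> polys_over ?R"
      unfolding p_def using \<eta>R
      by (intro P_over Rset.divide_closed S) (auto simp: power_inverse[symmetric] intro: Rset.power_closed)
    have num: "numer \<alpha> \<beta> i r r' y = poly p y * (\<Prod>t\<in>?I. \<eta> - ?\<zeta> t) / (y - \<eta>)" if "y \<noteq> \<eta>" for y
    proof -
      have "(\<Prod>t\<in>?I. \<eta> - ?\<zeta> t) = \<eta> ^ a (i - 1) * (\<Prod>t\<in>?I. 1 - ?\<zeta> t / \<eta>)"
        using prod_diff_factor[OF \<eta>0, of ?\<zeta> ?I] by simp
      then show ?thesis
        unfolding numer_def p_def poly_P ab(3) \<eta>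
        using remove[of "r i" "{1..a i}" y] ri ab that \<eta> \<eta>0
        by (simp add: S_def mult_ac)
    qed
    have "\<exists>q\<in>polys_over ?R.
      poly p zK * (\<Prod>t\<in>?I. \<eta> - ?\<zeta> t) / (zK - \<eta>) / (\<Prod>t\<in>?I. zK - ?\<zeta> t) = poly q zK
        + (\<Sum>t\<in>?I. poly p (?\<zeta> t) * (\<Prod>t\<in>?I. \<eta> - ?\<zeta> t) / (?\<zeta> t - \<eta>)
        / (\<Prod>s\<in>?I - {t}. ?\<zeta> t - ?\<zeta> s) / (zK - ?\<zeta> t)) + poly p \<eta> / (zK - \<eta>)"
    proof (rule Rset.partial_fractions_extra_pole[OF finite_atLeastAtMost p inj \<zeta> inv zK_neq_pole \<eta>R(1)])
      show "\<eta> \<noteq> ?\<zeta> t" for t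
        using shifted_root_neq(2)[OF i(1), of t \<alpha> r "r i"] \<eta> by simp
      show "zK \<noteq> \<eta>" by (simp add: \<eta>_def zK_neq_pole)
    qed
    then obtain q where q: "q \<in> polys_over ?R"
      "poly p zK * (\<Prod>t\<in>?I. \<eta> - ?\<zeta> t) / (zK - \<eta>) / (\<Prod>t\<in>?I. zK - ?\<zeta> t) = poly q zK
        + (\<Sum>t\<in>?I. poly p (?\<zeta> t) * (\<Prod>t\<in>?I. \<eta> - ?\<zeta> t) / (?\<zeta> t - \<eta>)
        / (\<Prod>s\<in>?I - {t}. ?\<zeta> t - ?\<zeta> s) / (zK - ?\<zeta> t)) + poly p \<eta> / (zK - \<eta>)"
      by (elim bexE) (rule that)
    have "(\<Sum>t\<in>?I. poly p (?\<zeta> t) * (\<Prod>t\<in>?I. \<eta> - ?\<zeta> t) / (?\<zeta> t - \<eta>)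
        / (\<Prod>s\<in>?I - {t}. ?\<zeta> t - ?\<zeta> s) / (zK - ?\<zeta> t))
        = (\<Sum>t\<in>?I. upper_res \<alpha> \<beta> i r r' t / (zK - ?\<zeta> t))"
      using shifted_root_neq(2)[OF i(1), of _ \<alpha> r "r i"] \<eta>
      by (intro sum.cong) (auto simp: upper_res_def num)
    moreover have "poly p \<eta> = diag_res \<alpha> \<beta> i r r'"
      unfolding p_def poly_P diag_res_def \<eta>_def[symmetric] S_def
      using \<eta>0 by (simp add: power_int_add mult_ac)
    moreover have "summand \<alpha> \<beta> i r r'
        = poly p zK * (\<Prod>t\<in>?I. \<eta> - ?\<zeta> t) / (zK - \<eta>) / (\<Prod>t\<in>?I. zK - ?\<zeta> t)"
      unfolding summand_def using num[of zK] zK_neq_pole \<eta>_def by simp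
    ultimately have "regular \<alpha> \<beta> i r r' = poly q zK"
      using q(2) True unfolding regular_def \<eta>_def by simp
    then show ?thesis using q(1) poly_zK_Rzset by simp
  next
    case False
    \<comment> \<open>The zeros left after cancelling the denominators of f and e; when both occur,
      r_i and r'_i differ in this case, so two zeros are available.\<close>
    define M where "M = {1..a i} - (if i < \<alpha> then {r i} else {}) - (if i < \<beta> then {r' i} else {})"
    define C where "C = S * (if i < \<beta> then (\<Prod>s=1..a (i - 1). 1 - ?\<zeta> s / ?\<eta> (r' i)) else 1)"
    define p where "p = P C (if i < \<beta> then 1 else 0) M"
    have "C \<in> ?R"
      unfolding C_def using S \<zeta> shifted_root_Rset[OF in' ri']
      by (auto intro!: R_mult Rset.prod_closed Rset.diff_closed Rset.divide_closed)
    then have p: "p \<in> polys_over ?R"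
      unfolding p_def by (intro P_over) (auto simp: M_def)
    have num: "numer \<alpha> \<beta> i r r' y = poly p y" if y: "\<And>s. y \<noteq> ?\<eta> s" for y
    proof -
      have "(\<Prod>s\<in>M. y - ?\<eta> s) = (\<Prod>s=1..a i. y - ?\<eta> s)
        * (if i < \<alpha> then 1 / (y - ?\<eta> (r i)) else 1) * (if i < \<beta> then 1 / (y - ?\<eta> (r' i)) else 1)"
      proof -
        have *: "(\<Prod>s=1..a i. y - ?\<eta> s) * (if i < \<alpha> then 1 / (y - ?\<eta> (r i)) else 1)
            = (\<Prod>s\<in>{1..a i} - (if i < \<alpha> then {r i} else {}). y - ?\<eta> s)"
          using remove[of "r i" "{1..a i}" y] ri y by auto
        show ?thesis
          unfolding * M_def
          using remove[of "r' i" "{1..a i} - (if i < \<alpha> then {r i} else {})" y] ri' y False by auto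
      qed
      then show ?thesis
        unfolding numer_def p_def poly_P C_def S_def[symmetric] by simp
    qed
    have "\<exists>q\<in>polys_over ?R. poly p zK / (\<Prod>t\<in>?I. zK - ?\<zeta> t) = poly q zK
        + (\<Sum>t\<in>?I. poly p (?\<zeta> t) / (\<Prod>s\<in>?I - {t}. ?\<zeta> t - ?\<zeta> s) / (zK - ?\<zeta> t))"
      by (rule Rset.partial_fractions[OF finite_atLeastAtMost p inj \<zeta> inv zK_neq_pole])
    then obtain q where q: "q \<in> polys_over ?R"
      "poly p zK / (\<Prod>t\<in>?I. zK - ?\<zeta> t) = poly q zK
        + (\<Sum>t\<in>?I. poly p (?\<zeta> t) / (\<Prod>s\<in>?I - {t}. ?\<zeta> t - ?\<zeta> s) / (zK - ?\<zeta> t))"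
      by (elim bexE) (rule that)
    have "(\<Sum>t\<in>?I. poly p (?\<zeta> t) / (\<Prod>s\<in>?I - {t}. ?\<zeta> t - ?\<zeta> s) / (zK - ?\<zeta> t))
        = (\<Sum>t\<in>?I. upper_res \<alpha> \<beta> i r r' t / (zK - ?\<zeta> t))"
      using shifted_root_neq(2)[OF i(1), of _ \<alpha> r]
      by (intro sum.cong) (auto simp: upper_res_def num)
    then have "regular \<alpha> \<beta> i r r' = poly q zK"
      using q(2) shifted_root_neq(1) unfolding regular_def summand_def if_not_P[OF False] by (simp add: num)
    then show ?thesis using q(1) poly_zK_Rzset by simp
  qed
qed

section \<open>Summation over i and over the tuples\<close>

lemma keys_Dexp_subset:
  assumes "1 \<le> i" "\<alpha> \<le> n" "r \<in> (\<Pi>\<^sub>E k\<in>{i..<\<alpha>}. {1..a k})"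
  shows "Poly_Mapping.keys (Dexp i \<alpha> r) \<subseteq> {(i, r). 1 \<le> i \<and> i < n \<and> 1 \<le> r \<and> r \<le> a i}"
proof clarify
  fix k s assume "(k, s) \<in> Poly_Mapping.keys (Dexp i \<alpha> r)"
  then have "i \<le> k \<and> k < \<alpha> \<and> r k = s"
    by (auto simp: in_keys_iff lookup_Dexp split: if_splits)
  then show "1 \<le> k \<and> k < n \<and> 1 \<le> s \<and> s \<le> a k"
    using assms by (auto dest!: PiE_mem[of _ _ _ k])
qed

lemma in_Atz_laxTn:
  assumes "\<alpha> \<le> n" "\<beta> \<le> n"
  shows "in_Atz n a (laxTn N is xs gam mup mum a \<alpha> \<beta>)"
proof -
  let ?A = "\<lambda>i. \<Pi>\<^sub>E k\<in>{i..<\<alpha>}. {1..a k}" and ?B = "\<lambda>i. \<Pi>\<^sub>E k\<in>{i..<\<beta>}. {1..a k}"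
  let ?m = "min \<alpha> \<beta>"
  let ?d = "\<lambda>i r r'. Dexp i \<alpha> r - Dexp i \<beta> r'"
  define G where "G i = (\<Sum>r\<in>?A i. \<Sum>r'\<in>?B i. Poly_Mapping.single (?d i r r')
    (\<Sum>t=1..a (i - 1). upper_res \<alpha> \<beta> i r r' t / (zK - pole (i - 1) t)))" for i
  define H where "H i = (\<Sum>r\<in>?A i. \<Sum>r'\<in>?B i. Poly_Mapping.single (?d i r r')
    (if i < \<alpha> \<and> i < \<beta> \<and> r i = r' i then diag_res \<alpha> \<beta> i r r' / (zK - pole i (r i)) else 0))" for i
  have G_H: "G (Suc j) = - H j" if j: "1 \<le> j" "j < ?m" for j
  proof -
    have ins: "{j..<\<alpha>} = insert j {Suc j..<\<alpha>}" "{j..<\<beta>} = insert j {Suc j..<\<beta>}"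
      using j by auto
    have "H j = (\<Sum>t=1..a j. \<Sum>r\<in>?A (Suc j). \<Sum>t'=1..a j. \<Sum>r'\<in>?B (Suc j).
      Poly_Mapping.single (?d j (r(j := t)) (r'(j := t')))
      (if t = t' then diag_res \<alpha> \<beta> j (r(j := t)) (r'(j := t')) / (zK - pole j t) else 0))"
      using j unfolding H_def ins by (simp add: sum_PiE_insert cong: if_cong)
    \<comment> \<open>With the entries \<open>t\<close>, \<open>t'\<close> at index \<open>j\<close>
      separated, only t = t' carries a pole, so one free index remains: the t that labels the poles
      of the summands for j + 1.\<close>
    also have "\<dots> = (\<Sum>t=1..a j. \<Sum>r\<in>?A (Suc j). \<Sum>t'=1..a j. if t' = t then \<Sum>r'\<in>?B (Suc j).
      Poly_Mapping.single (?d j (r(j := t)) (r'(j := t)))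
      (diag_res \<alpha> \<beta> j (r(j := t)) (r'(j := t)) / (zK - pole j t)) else 0)"
      by (intro sum.cong) auto
    also have "\<dots> = (\<Sum>t=1..a j. \<Sum>r\<in>?A (Suc j). \<Sum>r'\<in>?B (Suc j).
      Poly_Mapping.single (?d j (r(j := t)) (r'(j := t)))
      (diag_res \<alpha> \<beta> j (r(j := t)) (r'(j := t)) / (zK - pole j t)))"
      by (intro sum.cong refl) (simp add: sum.delta)
    also have "\<dots> = (\<Sum>t=1..a j. \<Sum>r\<in>?A (Suc j). \<Sum>r'\<in>?B (Suc j).
      - Poly_Mapping.single (?d (Suc j) r r') (upper_res \<alpha> \<beta> (Suc j) r r' t / (zK - pole j t)))"
    proof (intro sum.cong refl)
      fix t r r' assume t: "t \<in> {1..a j}" and r: "r \<in> ?A (Suc j)" and r': "r' \<in> ?B (Suc j)"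
      have "upper_res \<alpha> \<beta> (Suc j) r r' t = - diag_res \<alpha> \<beta> j (r(j := t)) (r'(j := t))"
        using j t r assms by (intro residues_cancel) (auto dest: PiE_mem)
      moreover have "?d j (r(j := t)) (r'(j := t)) = ?d (Suc j) r r'"
        using j by (simp add: Dexp_step)
      ultimately show "Poly_Mapping.single (?d j (r(j := t)) (r'(j := t)))
        (diag_res \<alpha> \<beta> j (r(j := t)) (r'(j := t)) / (zK - pole j t))
        = - Poly_Mapping.single (?d (Suc j) r r') (upper_res \<alpha> \<beta> (Suc j) r r' t / (zK - pole j t))"
        by (simp add: single_uminus)
    qed
    also have "\<dots> = - G (Suc j)"
    proof -
      have single_sum: "Poly_Mapping.single e (sum f T) = (\<Sum>t\<in>T. Poly_Mapping.single e (f t))"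
        for e :: "nat \<times> nat \<Rightarrow>\<^sub>0 int" and f :: "nat \<Rightarrow> K" and T
        by (induction T rule: infinite_finite_induct) (auto simp: single_add)
      show ?thesis
        unfolding G_def sum_negf single_sum diff_Suc_1
        by (subst sum.swap, rule arg_cong[where f = uminus], intro sum.cong refl sum.swap)
    qed
    finally show ?thesis by simp
  qed
  have "(\<Sum>i=1..?m. G i + H i) = 0"
  proof (cases ?m)
    case (Suc k)
    \<comment> \<open>The two unmatched ends of the telescoping: no poles from level 0 here, and no
      coinciding index at i = min(\<alpha>, \<beta>) next.\<close>
    have "G 1 = 0" unfolding G_def by (simp add: a_0)
    moreover have "H (Suc k) = 0"
      using Suc unfolding H_def by (auto intro!: sum.neutral)
    moreover have "(\<Sum>i=1..Suc k. G i) = G 1 + (\<Sum>i=1..k. G (Suc i))"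
      by (simp add: sum.atLeast_Suc_atMost sum.shift_bounds_cl_Suc_ivl del: sum.cl_ivl_Suc)
    moreover have "(\<Sum>i=1..Suc k. H i) = (\<Sum>i=1..k. H i) + H (Suc k)"
      by simp
    moreover have "(\<Sum>i=1..k. G (Suc i)) = - (\<Sum>i=1..k. H i)"
      unfolding sum_negf[symmetric] using Suc by (intro sum.cong) (auto simp: G_H)
    ultimately have "(\<Sum>i=1..Suc k. G i) + (\<Sum>i=1..Suc k. H i) = 0"
      by (simp only: add_0_left add_0_right left_minus)
    then show ?thesis unfolding Suc by (simp only: sum.distrib)
  qed simp
  moreover have "laxTn N is xs gam mup mum a \<alpha> \<beta> = (\<Sum>i=1..?m. (\<Sum>r\<in>?A i. \<Sum>r'\<in>?B i.
      Poly_Mapping.single (?d i r r') (regular \<alpha> \<beta> i r r')) + (G i + H i))"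
    unfolding laxTn_eq[OF assms(1)] G_def H_def sum.distrib[symmetric] single_add[symmetric]
    by (simp add: regular_def)
  ultimately have "laxTn N is xs gam mup mum a \<alpha> \<beta> = (\<Sum>i=1..?m. \<Sum>r\<in>?A i. \<Sum>r'\<in>?B i.
      Poly_Mapping.single (?d i r r') (regular \<alpha> \<beta> i r r'))"
    by (simp add: sum.distrib)
  moreover have "in_Atz n a (\<Sum>i=1..?m. \<Sum>r\<in>?A i. \<Sum>r'\<in>?B i.
      Poly_Mapping.single (?d i r r') (regular \<alpha> \<beta> i r r'))"
  proof (intro in_Atz_sum in_Atz_single)
    fix i r r' assume *: "i \<in> {1..?m}" "r \<in> ?A i" "r' \<in> ?B i"
    show "regular \<alpha> \<beta> i r r' \<in> Rzset n a"
      using * assms by (intro regular_Rzset) auto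
    show "Poly_Mapping.keys (?d i r r') \<subseteq> {(i, r). 1 \<le> i \<and> i < n \<and> 1 \<le> r \<and> r \<le> a i}"
      using keys_Dexp_subset[of i \<alpha> r] keys_Dexp_subset[of i \<beta> r'] * assms
        keys_diff[of "Dexp i \<alpha> r" "Dexp i \<beta> r'"] by auto
  qed
  ultimately show ?thesis by simp
qed

end

theorem theorem3p20:
  fixes n N :: nat and "is" :: "nat \<Rightarrow> nat" and xs :: "nat \<Rightarrow> complex"
    and gam mup mum :: "nat \<Rightarrow> int" and a :: "nat \<Rightarrow> nat"
  assumes "n \<ge> 2"
    and "trig_divisor n N is xs gam mup mum"
    and "integrality n N is gam mup mum a"
  shows "\<forall>\<alpha>\<in>{1..n}. \<forall>\<beta>\<in>{1..n}. in_Atz n a (laxTn N is xs gam mup mum a \<alpha> \<beta>)"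
proof -
  interpret trig_lax n N "is" xs gam mup mum a
    using assms by unfold_locales
  show ?thesis by (simp add: in_Atz_laxTn)
qed

end
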